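(* Let $E\subset\mathbb{R}$ be the set constructed as follows. Let $E_0=\{0,1\}$ and $t_n=1-\frac1{2n}$ for $n\in\mathbb{N}=\{1,2,\dots\}$. For every $n\in\mathbb{N}$ let $E_n=E_{n-1}\cup E_{n-1}^1\cup E_{n-1}^2$, where $E_{n-1}^1$ is the translation of the dilated set $t_nE_{n-1}$ whose first (smallest) point is the last (largest) point of $E_{n-1}$, and $E_{n-1}^2$ is the translation of $E_{n-1}$ whose first point is the last point of $E_{n-1}^1$. Let $E^+=\bigcup_{n=0}^\infty E_n$ and $E=E^+\cup(-E^+)$. Then for all $0<\alpha<1$ and all $1<p<\infty$, $\operatorname{dist}(\cdot,E)^{-\alpha}\in A_p\setminus A_1$. In particular, $E$ is not weakly porous and $\operatorname{Mu}(E)=0$.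
   Context: All notions are in $\mathbb{R}$ (dimension one). $|\cdot|$ is Lebesgue measure; $B(x,r)=(x-r,x+r)$; $\operatorname{dist}(x,E)^{-\alpha}=+\infty$ where $\operatorname{dist}(x,E)=0$. A cube in $\mathbb{R}$ is a half-open bounded interval $Q=[a,b)$, $\ell(Q)=b-a>0$. For such $P$, $\mathcal{D}(P)$ is the collection of all intervals obtained, for $j=0,1,2,\dots$, by dividing $P$ into $2^j$ disjoint half-open intervals of length $2^{-j}\ell(P)$. A weight is a locally integrable function $w$ with $w>0$ almost everywhere. A weight $w$ is in $A_1$ if there is $C$ with $\frac1{|Q|}\int_Q w\,dx\le C\operatorname{ess\,inf}_{Q}w$ for every cube $Q\subset\mathbb{R}$; for $1<p<\infty$ it is in $A_p$ if there is $C$ with $\frac1{|Q|}\int_Q w\,dx\,\bigl(\frac1{|Q|}\int_Q w^{\frac1{1-p}}dx\bigr)^{p-1}\le C$ for every cube $Q\subset\mathbb{R}$. Weak porosity: $Q\in\mathcal{D}(P)$ is $E$-free if $E\cap Q=\emptyset$; $\mathcal{M}(P)$ is a (fixed choice of a) largest $E$-free element of $\mathcal{D}(P)$. A nonempty set $E$ is weakly porous if there are constants $0<c,\delta<1$ such that for every cube $P$ there exist $N\in\mathbb{N}$ and pairwise disjoint $E$-free $Q_1,\dots,Q_N\in\mathcal{D}(P)$ with $|Q_k|\ge\delta|\mathcal{M}(P)|$ for all $k$ and $\sum_{k=1}^N|Q_k|\ge c|P|$ (in particular, every $P$ is required to have an $E$-free dyadic subcube). Muckenhoupt exponent: $h_E(B(x,r))$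 is the supremum of all $t>0$ such that $B(y,t)\subset B(x,r)\setminus E$ for some $y\in B(x,r)$ ($0$ if there is no such $t$). Let $E_{(r)}=\{y\in\mathbb{R}:\operatorname{dist}(y,E)<r\}$. If $h_E(B(x,R))>0$ for every $x\in E$ and $R>0$, then $\operatorname{Mu}(E)$ is the supremum of the numbers $\alpha\in\mathbb{R}$ for which there is a constant $C$ such that $\frac{|E_{(r)}\cap B(x,R)|}{|B(x,R)|}\le C\bigl(\frac{h_E(B(x,R))}{r}\bigr)^{-\alpha}$ for every $x\in E$ and $0<r<h_E(B(x,R))\le R$. If $h_E(B(x,R))=0$ for some $x\in E$, $R>0$, then $\operatorname{Mu}(E)=0$. *)

theory Defs
  imports "HOL-Analysis.Analysis"
begin

section \<open>Muckenhoupt weights on the real line\<close>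

text \<open>Weights take values in \<^typ>\<open>ennreal\<close>, so that a negative power of the distance to
  \<open>E\<close> can be infinite where this distance vanishes. The power function on \<^typ>\<open>ennreal\<close>
  follows the conventions \<open>0\<close> to a negative power is \<open>\<infinity>\<close> and \<open>\<infinity>\<close> to a negative power is
  \<open>0\<close>.\<close>

definition epowr :: "ennreal \<Rightarrow> real \<Rightarrow> ennreal" where
  "epowr x a =
     (if a = 0 then 1
      else if x = 0 then (if a < 0 then \<infinity> else 0)
      else if x = \<infinity> then (if a < 0 then 0 else \<infinity>)
      else ennreal (enn2real x powr a))"

definition is_cube :: "real set \<Rightarrow> bool" where
  "is_cube Q \<longleftrightarrow> (\<exists>a b. a < b \<and> Q = {a..<b})"

definition average :: "real set \<Rightarrow> (real \<Rightarrow> ennreal) \<Rightarrow> ennreal" where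
  "average Q w = (\<integral>\<^sup>+x\<in>Q. w x \<partial>lebesgue) / emeasure lebesgue Q"

definition ess_inf_on :: "real set \<Rightarrow> (real \<Rightarrow> ennreal) \<Rightarrow> ennreal" where
  "ess_inf_on Q w = Sup {c. AE x in lebesgue. x \<in> Q \<longrightarrow> c \<le> w x}"

definition weight :: "(real \<Rightarrow> ennreal) \<Rightarrow> bool" where
  "weight w \<longleftrightarrow>
     w \<in> borel_measurable lebesgue \<and>
     (\<forall>K. compact K \<longrightarrow> (\<integral>\<^sup>+x\<in>K. w x \<partial>lebesgue) < \<infinity>) \<and>
     (AE x in lebesgue. 0 < w x)"

definition A_1 :: "(real \<Rightarrow> ennreal) set" where
  "A_1 = {w. weight w \<and>
     (\<exists>C::real. \<forall>Q. is_cube Q \<longrightarrow> average Q w \<le> ennreal C * ess_inf_on Q w)}"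

text \<open>Only meaningful for \<open>1 < p\<close>. For a weight, the average of \<open>w\<close> is positive and finite and
  the average of the negative power is positive, so no product \<open>0 * \<infinity>\<close> occurs.\<close>

definition A_p :: "real \<Rightarrow> (real \<Rightarrow> ennreal) set" where
  "A_p p = {w. weight w \<and>
     (\<exists>C::real. \<forall>Q. is_cube Q \<longrightarrow>
        average Q w * epowr (average Q (\<lambda>x. epowr (w x) (1 / (1 - p)))) (p - 1) \<le> ennreal C)}"

definition dist_weight :: "real set \<Rightarrow> real \<Rightarrow> real \<Rightarrow> ennreal" where
  "dist_weight E \<alpha> x = epowr (ennreal (infdist x E)) (- \<alpha>)"


section \<open>Weak porosity\<close>

definition dyadic :: "real set \<Rightarrow> real set set" where
  "dyadic P = {Q. \<exists>a b. \<exists>j k::nat. a < b \<and> P = {a..<b} \<and> k < 2 ^ j \<and>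
     Q = {a + real k * ((b - a) / 2 ^ j) ..< a + real (k + 1) * ((b - a) / 2 ^ j)}}"

definition free_dyadic :: "real set \<Rightarrow> real set \<Rightarrow> real set set" where
  "free_dyadic E P = {Q \<in> dyadic P. E \<inter> Q = {}}"

text \<open>Unspecified if \<open>P\<close> has no \<open>E\<close>-free dyadic subcube; in that case the condition in
  \<open>weakly_porous\<close> below fails for \<open>P\<close>, whatever the value is.\<close>

definition max_free :: "real set \<Rightarrow> real set \<Rightarrow> real set" where
  "max_free E P =
     (SOME Q. Q \<in> free_dyadic E P \<and>
        (\<forall>Q'\<in>free_dyadic E P. measure lebesgue Q' \<le> measure lebesgue Q))"

definition weakly_porous :: "real set \<Rightarrow> bool" where
  "weakly_porous E \<longleftrightarrow> E \<noteq> {} \<and>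
     (\<exists>c \<delta>::real. 0 < c \<and> c < 1 \<and> 0 < \<delta> \<and> \<delta> < 1 \<and>
       (\<forall>P. is_cube P \<longrightarrow>
         (\<exists>(N::nat) Q. 1 \<le> N \<and>
            (\<forall>k\<in>{1..N}. Q k \<in> free_dyadic E P \<and>
               measure lebesgue (Q k) \<ge> \<delta> * measure lebesgue (max_free E P)) \<and>
            disjoint_family_on Q {1..N} \<and>
            (\<Sum>k=1..N. measure lebesgue (Q k)) \<ge> c * measure lebesgue P)))"


section \<open>Muckenhoupt exponent\<close>

definition hole :: "real set \<Rightarrow> real set \<Rightarrow> real" where
  "hole E B = Sup (insert 0 {t. 0 < t \<and> (\<exists>y\<in>B. ball y t \<subseteq> B - E)})"

definition nbhd :: "real set \<Rightarrow> real \<Rightarrow> real set" where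
  "nbhd E r = {y. infdist y E < r}"

text \<open>The supremum is taken in \<^typ>\<open>ereal\<close>, as the set of admissible exponents may be
  unbounded above.\<close>

definition Mu :: "real set \<Rightarrow> ereal" where
  "Mu E =
     (if \<forall>x\<in>E. \<forall>R>0. hole E (ball x R) > 0
      then Sup (ereal ` {\<alpha>. \<exists>C::real. \<forall>x\<in>E. \<forall>r R.
             0 < r \<and> r < hole E (ball x R) \<and> hole E (ball x R) \<le> R \<longrightarrow>
             measure lebesgue (nbhd E r \<inter> ball x R) / measure lebesgue (ball x R)
               \<le> C * (hole E (ball x R) / r) powr (- \<alpha>)})
      else 0)"


section \<open>The example set\<close>

definition t_seq :: "nat \<Rightarrow> real" where
  "t_seq n = 1 - 1 / (2 * real n)"

definition translate_to :: "real \<Rightarrow> real set \<Rightarrow> real set" where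
  "translate_to c A = (\<lambda>x. x - Min A + c) ` A"

fun E_stage :: "nat \<Rightarrow> real set" where
  "E_stage 0 = {0, 1}"
| "E_stage (Suc n) =
     (let A = E_stage n;
          A1 = translate_to (Max A) ((\<lambda>x. t_seq (Suc n) * x) ` A);
          A2 = translate_to (Max A1) A
      in A \<union> A1 \<union> A2)"

definition E_plus :: "real set" where
  "E_plus = (\<Union>n. E_stage n)"

definition E_set :: "real set" where
  "E_set = E_plus \<union> uminus ` E_plus"

text \<open>The uses of \<^const>\<open>Min\<close> and \<^const>\<open>Max\<close> above are on finite nonempty sets.\<close>

lemma finite_E_stage: "finite (E_stage n)"
  by (induction n) (auto simp: Let_def translate_to_def)

lemma E_stage_nonempty: "E_stage n \<noteq> {}"
  by (induction n) (auto simp: Let_def)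

end

theory Submission
  imports Defs
begin

text \<open>
  The nonnegative part of the set is a sequence of points \<open>0 = x\<^sub>0 < x\<^sub>1 < \<dots>\<close>, and the length
  \<open>g m\<close> of its \<open>m\<close>-th gap can be read off the ternary digits of \<open>m\<close>: it is the product of
  those \<open>t\<^sub>i\<close> for which the \<open>i\<close>-th digit of \<open>m\<close> is \<open>1\<close>. All four claims are statements about
  this sequence, since \<open>dist(x, E)\<^sup>s\<close> has over a gap of length \<open>g\<close> an integral comparable to
  \<open>g\<^bsup>1+s\<^esup>\<close> for every \<open>s > -1\<close>. Three features of the sequence carry the proof.

  It is multiplicative: over an aligned block of \<open>3\<^sup>n\<close> consecutive indices the sum of \<open>g\<^sup>s\<close> is
  \<open>G\<^sup>s \<Prod>\<^bsub>i\<le>n\<^esub> (2 + t\<^sub>i\<^sup>s)\<close>, where \<open>G\<close> depends on the higher digits only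
  (\<open>sum_gap_block\<close>). It is slowly varying: consecutive gaps differ by at most a factor \<open>2\<close>
  (\<open>gap_adjacent\<close>), because a carry only turns digits \<open>2\<close> into \<open>0\<close>, and neither contributes
  a factor. And \<open>u\<^sub>i = 1 - t\<^sub>i = 1/(2i)\<close> is square summable but not summable.

  Square summability gives \<open>A\<^sub>p\<close>. With \<open>\<beta> = \<alpha>/(p-1)\<close> and \<open>\<gamma> = p-1 = \<alpha>/\<beta>\<close>, the condition for a union of
  gaps says that \<open>(\<Sum> g\<^bsup>1-\<alpha>\<^esup>) (\<Sum> g\<^bsup>1+\<beta>\<^esup>)\<^sup>\<gamma> \<le> C (\<Sum> g)\<^bsup>1+\<gamma>\<^esup>\<close>. For a block, \<open>G\<close> cancels and the
  quotient of the two sides is a product over \<open>i\<close>. Its factors have no linear term in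
  \<open>u\<^sub>i\<close>, since the contributions \<open>\<alpha>u\<^sub>i/3\<close> and \<open>-\<gamma>\<beta>u\<^sub>i/3\<close> cancel, so that the product
  stays bounded (\<open>block_sum_comparison\<close>). A general range of indices contains a block and is
  contained in two adjacent blocks of the next size, which reduces it to the case of a block
  (\<open>sum_gap_comparison\<close>). An interval that meets at least three gaps is comparable to the union of
  the gaps it meets; on an interval that meets at most two gaps the distance behaves like a power
  weight (\<open>dist_integral_product_two_gaps\<close>).

  Divergence of \<open>\<Sum> u\<^sub>i\<close> gives everything else. The sum of \<open>g\<^sup>2\<close> over the first \<open>3\<^sup>n\<close> gaps is
  negligible against the sum \<open>L\<^sub>n\<close> of \<open>g\<close> (\<open>block_sum_square_negligible\<close>), so for every fixed
  \<open>r\<close> almost all of \<open>[0, L\<^sub>n)\<close> lies within \<open>r\<close> of \<open>E\<close> when \<open>n\<close> is suitably chosen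
  (\<open>far_points_negligible\<close>). But \<open>[0, L\<^sub>n)\<close> also contains the gap \<open>(0, 1)\<close>. Hence the average
  of \<open>dist(\<sqdot>, E)\<^bsup>-\<alpha>\<^esup>\<close> over this interval exceeds any multiple of its essential infimum, the free
  dyadic intervals that are not much smaller than a largest one cover a negligible part of it, and
  the \<open>r\<close>-neighbourhood fills a fixed fraction of it although \<open>h/r\<close> is as large as
  desired, where \<open>h\<close> is the radius of its largest hole.
\<close>

section \<open>Gap lengths and the points of the set\<close>

text \<open>
  The ternary digits of \<open>m\<close>, lowest first, select the factors \<open>t\<^bsub>k+1\<^esub>, t\<^bsub>k+2\<^esub>, \<dots>\<close>. The
  gaps of the set are the values with \<open>k = 0\<close>; the offset \<open>k\<close> is there because dropping the
  lowest \<open>k\<close> digits of an index leads from \<open>gap 0\<close> to \<open>gap k\<close>.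
\<close>

fun gap :: "nat \<Rightarrow> nat \<Rightarrow> real" where
  "gap k m = (if m = 0 then 1
     else (if m mod 3 = 1 then t_seq (Suc k) else 1) * gap (Suc k) (m div 3))"

declare gap.simps [simp del]

lemma t_seq_bounds: "1 / 2 \<le> t_seq (Suc n)" "t_seq (Suc n) \<le> 1" "0 < t_seq (Suc n)"
  by (simp_all add: t_seq_def field_simps)

lemma gap_0 [simp]: "gap k 0 = 1"
  by (simp add: gap.simps)

lemma gap_rec: "gap k m = (if m mod 3 = 1 then t_seq (Suc k) else 1) * gap (Suc k) (m div 3)"
  by (cases "m = 0") (simp_all add: gap.simps[of k m])

lemma gap_pos: "0 < gap k m"
proof (induction k m rule: gap.induct)
  case (1 k m)
  then show ?case
    using t_seq_bounds[of k] by (subst gap.simps) auto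
qed

text \<open>The factorization behind all block sums: the lowest \<open>n\<close> digits of an index and the remaining
  ones contribute independently.\<close>

lemma gap_split:
  assumes "r < 3 ^ n"
  shows "gap k (3 ^ n * q + r) = gap k r * gap (k + n) q"
  using assms
proof (induction n arbitrary: k r)
  case (Suc n)
  have "(3 ^ Suc n * q + r) mod 3 = r mod 3"
    by (metis mod_mult_self4 mult.assoc power_Suc)
  moreover have "(3 ^ Suc n * q + r) div 3 = 3 ^ n * q + r div 3"
    by (simp add: mult.assoc)
  moreover have "r div 3 < 3 ^ n"
    using Suc.prems by simp
  ultimately show ?case
    using Suc.IH[of "r div 3" "Suc k"] gap_rec[of k "3 ^ Suc n * q + r"] gap_rec[of k r] by simp
qed simp

text \<open>Passing from \<open>m\<close> to \<open>Suc m\<close> turns trailing digits \<open>2\<close> into \<open>0\<close>, which changes no factor,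
  and raises one further digit by one, which inserts or deletes a single factor \<open>t\<^sub>i \<ge> 1/2\<close>.\<close>

lemma gap_adjacent: "gap k (Suc m) \<le> 2 * gap k m" "gap k m \<le> 2 * gap k (Suc m)"
proof (induction k m rule: gap.induct)
  case (1 k m)
  note t = t_seq_bounds[of k]
  note G = gap_pos[of "Suc k" "m div 3"]
  have *: "t_seq (Suc k) * gap (Suc k) (m div 3) \<ge> 1 / 2 * gap (Suc k) (m div 3)"
    "t_seq (Suc k) * gap (Suc k) (m div 3) \<le> 1 * gap (Suc k) (m div 3)"
    using t G by (auto intro!: mult_right_mono)
  consider "m mod 3 = 0" | "m mod 3 = 1" | "m mod 3 = 2" by linarith
  then have "gap k (Suc m) \<le> 2 * gap k m \<and> gap k m \<le> 2 * gap k (Suc m)"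
  proof cases
    case 3
    then have d: "Suc m mod 3 = 0" "Suc m div 3 = Suc (m div 3)" "m \<noteq> 0" by presburger+
    show ?thesis
      using 1[OF d(3)] gap_rec[of k m] gap_rec[of k "Suc m"] 3 d by simp
  next
    case 1
    then have d: "Suc m mod 3 = 1" "Suc m div 3 = m div 3" by presburger+
    show ?thesis
      using gap_rec[of k m] gap_rec[of k "Suc m"] 1 d * G by simp
  next
    case 2
    then have d: "Suc m mod 3 = 2" "Suc m div 3 = m div 3" by presburger+
    show ?thesis
      using gap_rec[of k m] gap_rec[of k "Suc m"] 2 d * G by simp
  qed
  then show "gap k (Suc m) \<le> 2 * gap k m" "gap k m \<le> 2 * gap k (Suc m)" by auto
qed

definition pt :: "nat \<Rightarrow> real" where
  "pt m = (\<Sum>i<m. gap 0 i)"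

lemma pt_0 [simp]: "pt 0 = 0" by (simp add: pt_def)

lemma pt_Suc: "pt (Suc m) = pt m + gap 0 m" by (simp add: pt_def)

lemma strict_mono_pt: "strict_mono pt"
  by (rule strict_monoI_Suc) (simp add: pt_Suc gap_pos)

lemma pt_le_iff [simp]: "pt i \<le> pt j \<longleftrightarrow> i \<le> j"
  by (rule strict_mono_less_eq[OF strict_mono_pt])

lemma pt_less_iff [simp]: "pt i < pt j \<longleftrightarrow> i < j"
  by (rule strict_mono_less[OF strict_mono_pt])

lemma gap_first: "gap k 1 = t_seq (Suc k)" "gap k 2 = 1"
  using gap_rec[of k 1] gap_rec[of k 2] by auto

text \<open>The two recursive copies in the construction, a dilated and a plain one, correspond to
  the leading digits \<open>1\<close> and \<open>2\<close>.\<close>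

lemma pt_second_block:
  assumes "r \<le> 3 ^ n"
  shows "pt (3 ^ n + r) = pt (3 ^ n) + t_seq (Suc n) * pt r"
  using assms
proof (induction r)
  case (Suc r)
  then show ?case
    using gap_split[of r n 0 1] by (simp add: pt_Suc gap_first[simplified] algebra_simps)
qed simp

lemma pt_third_block:
  assumes "r \<le> 3 ^ n"
  shows "pt (2 * 3 ^ n + r) = pt (2 * 3 ^ n) + pt r"
  using assms
proof (induction r)
  case (Suc r)
  then show ?case
    using gap_split[of r n 0 2] by (simp add: pt_Suc gap_first mult.commute)
qed simp

lemma atMost_pow3_Suc:
  "{..3 ^ Suc n} = {..3 ^ n} \<union> (+) (3 ^ n) ` {..3 ^ n} \<union> (+) (2 * 3 ^ n) ` {..3 ^ n :: nat}"
proof -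
  have "x \<in> {..3 ^ n} \<union> (+) (3 ^ n) ` {..3 ^ n} \<union> (+) (2 * 3 ^ n) ` {..3 ^ n}"
    if "x \<le> 3 ^ Suc n" for x :: nat
  proof -
    consider "x \<le> 3 ^ n" | "3 ^ n \<le> x" "x - 3 ^ n \<le> 3 ^ n" | "2 * 3 ^ n \<le> x"
      by linarith
    then show ?thesis
    proof cases
      case 2
      then have "x = 3 ^ n + (x - 3 ^ n)" by simp
      then show ?thesis using 2 by blast
    next
      case 3
      then have "x = 2 * 3 ^ n + (x - 2 * 3 ^ n)" "x - 2 * 3 ^ n \<le> 3 ^ n"
        using that by auto
      then show ?thesis by blast
    qed auto
  qed
  then show ?thesis by auto
qed

lemma E_stage_eq: "E_stage n = pt ` {..3 ^ n}"
proof (induction n)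
  case 0
  have "pt 1 = 1" by (simp add: pt_def)
  then show ?case by (auto simp: atMost_Suc)
next
  case (Suc n)
  let ?A = "pt ` {..3 ^ n}" and ?t = "t_seq (Suc n)"
  note t = t_seq_bounds[of n]
  have minA: "Min ?A = 0"
    by (intro Min_eqI) (auto simp: image_iff pt_le_iff[of 0, simplified] intro!: bexI[of _ 0])
  have maxA: "Max ?A = pt (3 ^ n)" by (intro Max_eqI) auto
  define A1 where "A1 = translate_to (Max ?A) ((\<lambda>x. ?t * x) ` ?A)"
  have "Min ((\<lambda>x. ?t * x) ` ?A) = 0"
    using t by (intro Min_eqI) (auto simp: image_iff pt_le_iff[of 0, simplified] intro!: bexI[of _ 0])
  then have A1: "A1 = pt ` (+) (3 ^ n) ` {..3 ^ n}"
    unfolding A1_def translate_to_def maxA image_image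
    by (intro image_cong) (auto simp: pt_second_block)
  have maxA1: "Max A1 = pt (2 * 3 ^ n)"
    unfolding A1 by (intro Max_eqI) (auto intro!: image_eqI[of _ _ "3 ^ n"] simp: mult_2)
  have A2: "translate_to (Max A1) ?A = pt ` (+) (2 * 3 ^ n) ` {..3 ^ n}"
    unfolding translate_to_def minA maxA1 image_image
    by (intro image_cong) (auto simp: pt_third_block)
  have "E_stage (Suc n) = ?A \<union> A1 \<union> translate_to (Max A1) ?A"
    by (simp add: Let_def Suc.IH A1_def)
  then show ?case
    unfolding A1 A2[unfolded A1] atMost_pow3_Suc image_Un by simp
qed

lemma E_plus_eq: "E_plus = range pt"
proof -
  have "\<exists>n. m \<le> 3 ^ n" for m :: nat
    by (rule exI[of _ m]) (simp add: less_imp_le power_gt_expt)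
  then show ?thesis
    unfolding E_plus_def E_stage_eq by blast
qed

section \<open>Power sums of gap lengths\<close>

definition block_sum :: "real \<Rightarrow> nat \<Rightarrow> real" where
  "block_sum s n = (\<Prod>i<n. 2 + t_seq (Suc i) powr s)"

lemma block_sum_pos: "0 < block_sum s n"
  unfolding block_sum_def by (intro prod_pos) (auto intro: add_pos_nonneg)

lemma sum_gap_block:
  "(\<Sum>m = 3 ^ n * q..<3 ^ n * Suc q. gap 0 m powr s) = gap n q powr s * block_sum s n"
proof -
  have shift: "(\<Sum>m = 3 ^ n * q..<3 ^ n * Suc q. gap 0 m powr s)
      = gap n q powr s * (\<Sum>r<3 ^ n. gap 0 r powr s)" for n q
  proof -
    have "(\<Sum>m = 3 ^ n * q..<3 ^ n * Suc q. gap 0 m powr s)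
        = (\<Sum>r = 0..<3 ^ n. gap 0 (3 ^ n * q + r) powr s)"
      using sum.shift_bounds_nat_ivl[of "\<lambda>m. gap 0 m powr s" 0 "3 ^ n * q" "3 ^ n"]
      by (simp add: add.commute)
    also have "\<dots> = (\<Sum>r = 0..<3 ^ n. gap n q powr s * gap 0 r powr s)"
      by (intro sum.cong) (auto simp: gap_split powr_mult gap_pos less_imp_le)
    finally show ?thesis by (simp add: sum_distrib_left lessThan_atLeast0)
  qed
  have "(\<Sum>r<3 ^ n. gap 0 r powr s) = block_sum s n"
  proof (induction n)
    case (Suc n)
    have "{..<3 ^ Suc n} = {3 ^ n * 0..<3 ^ n * Suc 0} \<union> {3 ^ n * 1..<3 ^ n * Suc 1}
        \<union> {3 ^ n * 2..<3 ^ n * Suc (2::nat)}"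
      by auto
    also have "(\<Sum>r\<in>\<dots>. gap 0 r powr s) = (\<Sum>r = 3 ^ n * 0..<3 ^ n * Suc 0. gap 0 r powr s)
      + (\<Sum>r = 3 ^ n * 1..<3 ^ n * Suc 1. gap 0 r powr s)
      + (\<Sum>r = 3 ^ n * 2..<3 ^ n * Suc 2. gap 0 r powr s)"
      by (subst sum.union_disjoint; (subst sum.union_disjoint)?) auto
    also have "\<dots> = (2 + t_seq (Suc n) powr s) * block_sum s n"
      unfolding shift Suc.IH gap_first by (simp add: algebra_simps)
    finally show ?case by (simp add: block_sum_def mult.commute)
  qed (simp add: block_sum_def)
  with shift show ?thesis by simp
qed

lemma pt_pow3: "pt (3 ^ n) = block_sum 1 n"
  using sum_gap_block[where n = n and q = 0 and s = 1, unfolded gap_0]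
  by (simp add: pt_def gap_pos less_imp_le lessThan_atLeast0)

text \<open>Take \<open>k\<close> maximal such that the range contains an aligned block of size \<open>3\<^sup>k\<close>. As it
  contains none of size \<open>3\<^bsup>k+1\<^esup>\<close>, it ends within the block of that size after the one where it
  starts.\<close>

lemma interval_between_blocks:
  fixes i j :: nat
  assumes "i \<le> j"
  obtains k q q' where "i \<le> 3 ^ k * q" "3 ^ k * Suc q \<le> Suc j"
    "3 ^ Suc k * q' \<le> i" "j < 3 ^ Suc k * (q' + 2)" "q div 3 = q' \<or> q div 3 = Suc q'"
proof -
  define P where "P k \<longleftrightarrow> (\<exists>q. i \<le> 3 ^ k * q \<and> 3 ^ k * Suc q \<le> Suc j)" for k
  have P0: "P 0" unfolding P_def using assms by auto
  have bound: "\<And>k. P k \<Longrightarrow> k \<le> Suc j"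
  proof -
    fix k assume "P k"
    then have "3 ^ k \<le> Suc j" unfolding P_def by (auto intro: add_leD1)
    moreover have "k < 3 ^ k" by (rule power_gt_expt) simp
    ultimately show "k \<le> Suc j" by linarith
  qed
  define k where "k = (GREATEST k. P k)"
  have Pk: "P k" unfolding k_def using P0 bound by (rule GreatestI_nat)
  have nPk: "\<not> P (Suc k)"
    using Greatest_le_nat[of P "Suc k" "Suc j"] bound unfolding k_def by force
  obtain q where q: "i \<le> 3 ^ k * q" "3 ^ k * Suc q \<le> Suc j" using Pk unfolding P_def by auto
  define q' where "q' = i div 3 ^ Suc k"
  have lo: "3 ^ Suc k * q' \<le> i" unfolding q'_def by (rule times_div_less_eq_dividend)
  have up: "i < 3 ^ Suc k * Suc q'"
    unfolding q'_def using dividend_less_times_div[of "3 ^ Suc k" i] by simp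
  have hi: "j < 3 ^ Suc k * (q' + 2)"
  proof (rule ccontr)
    assume "\<not> ?thesis"
    then have "i \<le> 3 ^ Suc k * Suc q' \<and> 3 ^ Suc k * Suc (Suc q') \<le> Suc j"
      using up by simp
    then show False using nPk unfolding P_def by blast
  qed
  have "3 ^ k * (3 * q') = 3 ^ Suc k * q'" by simp
  also have "\<dots> \<le> 3 ^ k * q" using lo q(1) by (rule order_trans)
  finally have "3 ^ k * (3 * q') \<le> 3 ^ k * q" .
  then have a: "3 * q' \<le> q" by (rule mult_left_le_imp_le) simp
  have "3 ^ k * q < 3 ^ k * (3 * (q' + 2))"
  proof -
    have "3 ^ k * q + 3 ^ k \<le> Suc j" using q(2) by simp
    moreover have "0 < (3::nat) ^ k" by simp
    ultimately have "3 ^ k * q \<le> j" by linarith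
    also note hi
    also have "3 ^ Suc k * (q' + 2) = 3 ^ k * (3 * (q' + 2))" by (simp add: algebra_simps)
    finally show ?thesis .
  qed
  then have b: "q < 3 * (q' + 2)" by (rule mult_left_less_imp_less) simp
  have "q' \<le> q div 3" using div_le_mono[OF a, of 3] by simp
  moreover have "q div 3 < q' + 2" using b by (simp add: less_mult_imp_div_less mult.commute)
  ultimately have "q div 3 = q' \<or> q div 3 = Suc q'" by linarith
  with q lo hi show ?thesis using that by blast
qed

text \<open>A Taylor bound at \<open>t = 1\<close>, written multiplicatively: with \<open>u = 1 - t\<close>, the relative change from
  \<open>2 + t\<close> to \<open>2 + t\<^sup>s\<close> is \<open>(1 - s) u / (2 + t)\<close> up to a quadratic error. Keeping \<open>2 + t\<close> in
  the denominator makes the linear terms for two different \<open>s\<close> cancel exactly. It follows from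
  \<open>t \<le> exp (-u)\<close> and \<open>exp (-y) \<le> 1 / (1 + y) \<le> 1 - y + y\<^sup>2\<close>.\<close>

lemma two_plus_powr_le:
  fixes s t :: real
  assumes "0 < s" "0 < t" "t \<le> 1"
  shows "2 + t powr s \<le> (2 + t) * exp (((1 - s) * (1 - t) + (s * (1 - t))\<^sup>2) / (2 + t))"
proof -
  define y where "y = s * (1 - t)"
  have y: "0 \<le> y" using assms by (simp add: y_def)
  have "t powr s \<le> exp (- (1 - t)) powr s"
    using assms exp_ge_add_one_self[of "- (1 - t)"] by (intro powr_mono2) auto
  also have "\<dots> = inverse (exp y)"
    by (simp add: powr_def exp_minus[symmetric] y_def algebra_simps)
  also have "\<dots> \<le> inverse (1 + y)"
    using y by (intro le_imp_inverse_le exp_ge_add_one_self) auto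
  also have "\<dots> \<le> 1 - y + y\<^sup>2"
  proof -
    have "1 \<le> (1 - y + y\<^sup>2) * (1 + y)"
      using y by (simp add: algebra_simps power2_eq_square)
    then show ?thesis using y by (simp add: inverse_eq_divide pos_divide_le_eq)
  qed
  finally have "2 + t powr s \<le> 2 + t + ((1 - s) * (1 - t) + y\<^sup>2)"
    by (simp add: algebra_simps y_def)
  also have "\<dots> = (2 + t) * (1 + ((1 - s) * (1 - t) + y\<^sup>2) / (2 + t))"
    using assms by (simp add: field_simps)
  also have "\<dots> \<le> (2 + t) * exp (((1 - s) * (1 - t) + y\<^sup>2) / (2 + t))"
    using assms by (intro mult_left_mono exp_ge_add_one_self) auto
  finally show ?thesis by (simp add: y_def)
qed

text \<open>The \<open>A\<^sub>p\<close> estimate for a single block. The exponents \<open>1 - \<alpha>\<close> and \<open>1 + \<beta>\<close> produce the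
  linear terms \<open>\<alpha> u\<close> and \<open>-\<beta> u\<close>, and the power \<open>\<alpha>/\<beta>\<close> is exactly the one for which they cancel;
  the quadratic errors are summable.\<close>

lemma block_sum_comparison:
  fixes \<alpha> \<beta> :: real
  assumes "0 < \<alpha>" "\<alpha> < 1" "0 < \<beta>"
  obtains C where "0 < C" "\<And>n. block_sum (1 - \<alpha>) n * block_sum (1 + \<beta>) n powr (\<alpha> / \<beta>)
    \<le> C * block_sum 1 n powr (1 + \<alpha> / \<beta>)"
proof -
  define \<gamma> K where "\<gamma> = \<alpha> / \<beta>" and "K = (1 - \<alpha>)\<^sup>2 + \<gamma> * (1 + \<beta>)\<^sup>2"
  have \<gamma>: "0 < \<gamma>" "\<gamma> * \<beta> = \<alpha>" using assms by (auto simp: \<gamma>_def)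
  define S where "S = (\<Sum>n. inverse ((real (Suc n))\<^sup>2))"
  have summ: "summable (\<lambda>n. inverse ((real (Suc n))\<^sup>2))"
    using inverse_power_summable[of 2, where 'a=real] by (subst summable_Suc_iff) auto
  have factor: "(2 + t powr (1 - \<alpha>)) * (2 + t powr (1 + \<beta>)) powr \<gamma>
      \<le> exp (K * (1 - t)\<^sup>2) * (2 + t) powr (1 + \<gamma>)" if t: "1 / 2 \<le> t" "t \<le> 1" for t
  proof -
    define u where "u = 1 - t"
    define a b where "a = (\<alpha> * u + ((1 - \<alpha>) * u)\<^sup>2) / (2 + t)"
      and "b = (- \<beta> * u + ((1 + \<beta>) * u)\<^sup>2) / (2 + t)"
    have 1: "2 + t powr (1 - \<alpha>) \<le> (2 + t) * exp a"
      using two_plus_powr_le[of "1 - \<alpha>" t] t assms by (simp add: a_def u_def)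
    have 2: "2 + t powr (1 + \<beta>) \<le> (2 + t) * exp b"
      using two_plus_powr_le[of "1 + \<beta>" t] t assms by (simp add: b_def u_def)
    have "(2 + t powr (1 - \<alpha>)) * (2 + t powr (1 + \<beta>)) powr \<gamma>
        \<le> ((2 + t) * exp a) * ((2 + t) * exp b) powr \<gamma>"
      using t \<gamma> by (intro mult_mono powr_mono2 1 2) auto
    also have "((2 + t) * exp b) powr \<gamma> = (2 + t) powr \<gamma> * exp (\<gamma> * b)"
      using t by (simp add: powr_mult) (simp add: powr_def)
    also have "((2 + t) * exp a) * ((2 + t) powr \<gamma> * exp (\<gamma> * b))
        = (2 + t) powr (1 + \<gamma>) * exp (a + \<gamma> * b)"
      using t by (simp add: powr_add exp_add)
    finally have 3: "(2 + t powr (1 - \<alpha>)) * (2 + t powr (1 + \<beta>)) powr \<gamma>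
        \<le> (2 + t) powr (1 + \<gamma>) * exp (a + \<gamma> * b)" .
    have "a + \<gamma> * b = (\<alpha> * u + ((1 - \<alpha>) * u)\<^sup>2
        + (- (\<gamma> * \<beta>) * u + \<gamma> * ((1 + \<beta>) * u)\<^sup>2)) / (2 + t)"
      unfolding a_def b_def add_divide_distrib by (simp add: algebra_simps diff_divide_distrib)
    also have "\<dots> = K * u\<^sup>2 / (2 + t)"
      unfolding \<gamma>(2) K_def power_mult_distrib by (simp add: algebra_simps)
    also have "\<dots> \<le> K * u\<^sup>2"
    proof -
      have "0 \<le> K * u\<^sup>2" using \<gamma> by (simp add: K_def)
      then have "K * u\<^sup>2 * 1 \<le> K * u\<^sup>2 * (2 + t)" using t by (intro mult_left_mono) auto
      then show ?thesis using t by (simp add: pos_divide_le_eq)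
    qed
    finally have "(2 + t) powr (1 + \<gamma>) * exp (a + \<gamma> * b) \<le> (2 + t) powr (1 + \<gamma>) * exp (K * u\<^sup>2)"
      by (intro mult_left_mono) auto
    with 3 show ?thesis by (simp add: u_def mult.commute)
  qed
  have "block_sum (1 - \<alpha>) n * block_sum (1 + \<beta>) n powr \<gamma>
      \<le> exp (K * S) * block_sum 1 n powr (1 + \<gamma>)" for n
  proof -
    let ?t = "\<lambda>i. t_seq (Suc i)"
    have "block_sum (1 - \<alpha>) n * block_sum (1 + \<beta>) n powr \<gamma>
        = (\<Prod>i<n. (2 + ?t i powr (1 - \<alpha>)) * (2 + ?t i powr (1 + \<beta>)) powr \<gamma>)"
      unfolding block_sum_def prod.distrib by (simp add: prod_powr_distrib)
    also have "\<dots> \<le> (\<Prod>i<n. exp (K * (1 - ?t i)\<^sup>2) * (2 + ?t i) powr (1 + \<gamma>))"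
      using t_seq_bounds by (intro prod_mono conjI factor mult_nonneg_nonneg) (auto intro: add_nonneg_nonneg)
    also have "\<dots> = exp (\<Sum>i<n. K * (1 - ?t i)\<^sup>2) * (\<Prod>i<n. (2 + ?t i)) powr (1 + \<gamma>)"
    proof -
      have "0 \<le> 2 + ?t i" for i using t_seq_bounds[of i] by simp
      then show ?thesis by (simp add: prod.distrib exp_sum prod_powr_distrib)
    qed
    also have "(\<Prod>i<n. (2 + ?t i)) = block_sum 1 n"
      using t_seq_bounds by (simp add: block_sum_def less_imp_le)
    also have "(\<Sum>i<n. K * (1 - ?t i)\<^sup>2) \<le> K * S"
    proof -
      have "(\<Sum>i<n. (1 - ?t i)\<^sup>2) \<le> (\<Sum>i<n. inverse ((real (Suc i))\<^sup>2))"
      proof (intro sum_mono)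
        fix i
        have "1 - ?t i = inverse (real (Suc i)) / 2" by (simp add: t_seq_def field_simps)
        then show "(1 - ?t i)\<^sup>2 \<le> inverse ((real (Suc i))\<^sup>2)"
          by (simp only: power_divide power_inverse) simp
      qed
      also have "\<dots> \<le> S"
        unfolding S_def using summ by (intro sum_le_suminf) auto
      finally show ?thesis using \<gamma>(1) by (simp add: K_def sum_distrib_left[symmetric] mult_left_mono)
    qed
    finally show ?thesis using block_sum_pos[of 1 n] by (simp add: mult_right_mono)
  qed
  then show ?thesis using that[of "exp (K * S)"] by (simp add: \<gamma>_def)
qed

text \<open>Between the block inside the range and the two blocks around it, all factors \<open>G\<close> and all
  block sums agree up to constants, so the estimate for blocks carries over. The powers of \<open>G\<close>
  cancel since \<open>(1 - \<alpha>) + (1 + \<beta>) \<alpha>/\<beta> = 1 + \<alpha>/\<beta>\<close>.\<close>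

lemma sum_gap_comparison:
  fixes \<alpha> \<beta> :: real
  assumes "0 < \<alpha>" "\<alpha> < 1" "0 < \<beta>"
  obtains C where "0 < C" "\<And>i j. i \<le> j \<Longrightarrow>
    (\<Sum>m = i..j. gap 0 m powr (1 - \<alpha>)) * (\<Sum>m = i..j. gap 0 m powr (1 + \<beta>)) powr (\<alpha> / \<beta>)
      \<le> C * (\<Sum>m = i..j. gap 0 m) powr (1 + \<alpha> / \<beta>)"
proof -
  define \<gamma> where "\<gamma> = \<alpha> / \<beta>"
  have \<gamma>: "0 < \<gamma>" "\<gamma> * \<beta> = \<alpha>" using assms by (auto simp: \<gamma>_def)
  obtain C where C: "0 < C" "\<And>n. block_sum (1 - \<alpha>) n * block_sum (1 + \<beta>) n powr \<gamma>
    \<le> C * block_sum 1 n powr (1 + \<gamma>)"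
    using block_sum_comparison[OF assms] unfolding \<gamma>_def by blast
  define c where "c s = 1 + 2 powr s" for s :: real
  have c: "0 < c s" for s by (simp add: c_def add_pos_nonneg)
  define C' where "C' = c (1 - \<alpha>) * c (1 + \<beta>) powr \<gamma> * C * 12 powr (1 + \<gamma>)"
  have "0 < c (1 + \<beta>) powr \<gamma>" using c[of "1 + \<beta>"] by simp
  then have "0 < C'" using c[of "1 - \<alpha>"] C(1) unfolding C'_def by (intro mult_pos_pos) auto
  moreover have "(\<Sum>m = i..j. gap 0 m powr (1 - \<alpha>)) * (\<Sum>m = i..j. gap 0 m powr (1 + \<beta>)) powr \<gamma>
      \<le> C' * (\<Sum>m = i..j. gap 0 m) powr (1 + \<gamma>)" if ij: "i \<le> j" for i j
  proof -
    obtain k q q' where k: "i \<le> 3 ^ k * q" "3 ^ k * Suc q \<le> Suc j"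
      "3 ^ Suc k * q' \<le> i" "j < 3 ^ Suc k * (q' + 2)" "q div 3 = q' \<or> q div 3 = Suc q'"
      using interval_between_blocks[OF ij] by blast
    define G where "G = gap (Suc k) q'"
    define D where "D s = block_sum s (Suc k)" for s
    have G: "0 < G" and D: "0 < D s" for s by (simp_all add: G_def gap_pos D_def block_sum_pos)
    have up: "(\<Sum>m = i..j. gap 0 m powr s) \<le> c s * (D s * G powr s)" if s: "0 < s" for s
    proof -
      have "(\<Sum>m = i..j. gap 0 m powr s)
          \<le> (\<Sum>m\<in>{3 ^ Suc k * q'..<3 ^ Suc k * Suc q'}
              \<union> {3 ^ Suc k * Suc q'..<3 ^ Suc k * Suc (Suc q')}. gap 0 m powr s)"
        using k(3,4) by (intro sum_mono2) auto
      also have "\<dots> = (\<Sum>m = 3 ^ Suc k * q'..<3 ^ Suc k * Suc q'. gap 0 m powr s)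
          + (\<Sum>m = 3 ^ Suc k * Suc q'..<3 ^ Suc k * Suc (Suc q'). gap 0 m powr s)"
        by (intro sum.union_disjoint) auto
      also have "\<dots> = D s * (G powr s + gap (Suc k) (Suc q') powr s)"
        unfolding sum_gap_block D_def G_def by (simp add: algebra_simps)
      also have "\<dots> \<le> D s * (G powr s + (2 * G) powr s)"
        using s gap_adjacent(1)[of "Suc k" q'] gap_pos D[of s] unfolding G_def
        by (intro mult_left_mono add_left_mono powr_mono2) (auto simp: less_imp_le)
      also have "\<dots> = c s * (D s * G powr s)"
        using G by (simp add: c_def powr_mult algebra_simps)
      finally show ?thesis .
    qed
    \<comment> \<open>The constant 12 collects a factor 3 from the block sums of sizes \<open>3\<^sup>k\<close> and \<open>3\<^bsup>k+1\<^esup>\<close>,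
      a factor 2 for one digit of \<open>q\<close> and a factor 2 for the adjacent block.\<close>
    have low: "D 1 * G \<le> 12 * (\<Sum>m = i..j. gap 0 m)"
    proof -
      have "gap (Suc k) (q div 3) \<le> 2 * gap k q"
        using gap_rec[of k q] t_seq_bounds[of k] gap_pos[of "Suc k" "q div 3"] by auto
      moreover have "G \<le> 2 * gap (Suc k) (q div 3)"
        using k(5) gap_adjacent(2)[of "Suc k" q'] gap_pos[of "Suc k" q'] unfolding G_def by auto
      ultimately have "G \<le> 4 * gap k q" by simp
      moreover have "D 1 \<le> 3 * block_sum 1 k"
        using t_seq_bounds[of k] block_sum_pos[of 1 k] by (simp add: D_def block_sum_def)
      ultimately have "D 1 * G \<le> (3 * block_sum 1 k) * (4 * gap k q)"
        using G block_sum_pos[of 1 k] by (intro mult_mono) auto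
      also have "\<dots> = 12 * (\<Sum>m = 3 ^ k * q..<3 ^ k * Suc q. gap 0 m powr 1)"
        unfolding sum_gap_block by (simp add: gap_pos less_imp_le)
      also have "\<dots> \<le> 12 * (\<Sum>m = i..j. gap 0 m powr 1)"
        using k(1,2) by (intro mult_left_mono sum_mono2) auto
      finally show ?thesis by (simp add: gap_pos less_imp_le)
    qed
    have "(\<Sum>m = i..j. gap 0 m powr (1 - \<alpha>)) * (\<Sum>m = i..j. gap 0 m powr (1 + \<beta>)) powr \<gamma>
        \<le> (c (1 - \<alpha>) * (D (1 - \<alpha>) * G powr (1 - \<alpha>)))
          * (c (1 + \<beta>) * (D (1 + \<beta>) * G powr (1 + \<beta>))) powr \<gamma>"
      using assms \<gamma> c D G
      by (intro mult_mono powr_mono2 up) (auto intro!: sum_nonneg mult_nonneg_nonneg simp: less_imp_le)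
    also have "\<dots> = c (1 - \<alpha>) * c (1 + \<beta>) powr \<gamma> * (D (1 - \<alpha>) * D (1 + \<beta>) powr \<gamma>)
        * (G powr (1 - \<alpha>) * (G powr (1 + \<beta>)) powr \<gamma>)"
      using c D G by (simp add: powr_mult less_imp_le)
    also have "G powr (1 - \<alpha>) * (G powr (1 + \<beta>)) powr \<gamma> = G powr (1 + \<gamma>)"
      using \<gamma>(2) by (simp add: powr_powr powr_add[symmetric] algebra_simps)
    also have "c (1 - \<alpha>) * c (1 + \<beta>) powr \<gamma> * (D (1 - \<alpha>) * D (1 + \<beta>) powr \<gamma>) * G powr (1 + \<gamma>)
        \<le> c (1 - \<alpha>) * c (1 + \<beta>) powr \<gamma> * (C * D 1 powr (1 + \<gamma>)) * G powr (1 + \<gamma>)"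
      using C(2)[of "Suc k"] c unfolding D_def[symmetric]
      by (intro mult_right_mono mult_left_mono) (auto simp: less_imp_le)
    also have "\<dots> = c (1 - \<alpha>) * c (1 + \<beta>) powr \<gamma> * C * (D 1 * G) powr (1 + \<gamma>)"
      using D G by (simp add: powr_mult less_imp_le)
    also have "\<dots> \<le> c (1 - \<alpha>) * c (1 + \<beta>) powr \<gamma> * C * (12 * (\<Sum>m = i..j. gap 0 m)) powr (1 + \<gamma>)"
      using low c C D G \<gamma> by (intro mult_left_mono powr_mono2) (auto simp: less_imp_le)
    also have "\<dots> = C' * (\<Sum>m = i..j. gap 0 m) powr (1 + \<gamma>)"
      unfolding C'_def by (subst powr_mult) (auto intro: sum_nonneg simp: gap_pos less_imp_le)
    finally show ?thesis .
  qed
  ultimately show ?thesis using that unfolding \<gamma>_def by blast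
qed

text \<open>Each factor of the quotient of the two products is at most \<open>1 - u/6\<close> with \<open>u = 1/(2i)\<close>,
  so the quotient decays like \<open>exp (- harm n / 12)\<close>: this is where the divergence of the
  harmonic series enters.\<close>

lemma block_sum_square_negligible:
  assumes "0 < \<epsilon>"
  obtains n where "block_sum 2 n \<le> \<epsilon> * block_sum 1 n"
proof -
  let ?t = "\<lambda>i. t_seq (Suc i)"
  have bound: "block_sum 2 n \<le> exp (- harm n / 12) * block_sum 1 n" for n
  proof -
    have "block_sum 2 n \<le> (\<Prod>i<n. exp (- inverse (of_nat (Suc i)) / 12) * (2 + ?t i))"
      unfolding block_sum_def
    proof (intro prod_mono conjI)
      fix i
      define u where "u = inverse (real (Suc i)) / 2"
      have u: "?t i = 1 - u" "0 \<le> u" "u \<le> 1 / 2"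
        by (auto simp: u_def t_seq_def field_simps)
      have "2 + (1 - u)\<^sup>2 \<le> (1 - u / 6) * (3 - u)"
      proof -
        have "0 \<le> u * (1 / 2 - 5 / 6 * u)" using u by (intro mult_nonneg_nonneg) auto
        moreover have "(1 - u / 6) * (3 - u) - (2 + (1 - u)\<^sup>2) = u * (1 / 2 - 5 / 6 * u)"
          by (simp add: field_simps power2_eq_square)
        ultimately show ?thesis by linarith
      qed
      also have "\<dots> \<le> exp (- u / 6) * (3 - u)"
        using u exp_ge_add_one_self[of "- u / 6"] by (intro mult_right_mono) auto
      finally show "2 + ?t i powr 2 \<le> exp (- inverse (of_nat (Suc i)) / 12) * (2 + ?t i)"
        using u by (simp add: u_def)
    qed (auto intro: add_nonneg_nonneg)
    also have "\<dots> = exp (- harm n / 12) * block_sum 1 n"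
    proof -
      have "(\<Prod>i<n. exp (- inverse (real (Suc i)) / 12)) = exp (- harm n / 12)"
        by (induction n) (auto simp: harm_Suc harm_def[of 0] exp_add[symmetric] diff_divide_distrib algebra_simps)
      then show ?thesis
        using t_seq_bounds by (simp add: prod.distrib block_sum_def less_imp_le)
    qed
    finally show ?thesis .
  qed
  have "eventually (\<lambda>n. (harm n :: real) \<ge> - 12 * ln \<epsilon>) sequentially"
    using harm_at_top by (simp add: filterlim_at_top)
  then obtain n where n: "(harm n :: real) \<ge> - 12 * ln \<epsilon>"
    by (auto simp: eventually_sequentially)
  then have "exp (- harm n / 12) \<le> exp (ln \<epsilon>)" by simp
  then have "exp (- harm n / 12) \<le> \<epsilon>" using assms by simp
  then have "block_sum 2 n \<le> \<epsilon> * block_sum 1 n"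
    using bound[of n] block_sum_pos[of 1 n] by (meson order_trans mult_right_mono less_imp_le)
  then show ?thesis using that by blast
qed

section \<open>The distance to the set\<close>

lemma block_sum_1_ge: "real n \<le> block_sum 1 n"
proof -
  have "2 ^ n \<le> block_sum 1 n"
  proof (induction n)
    case (Suc n)
    have "2 ^ n * 2 \<le> block_sum 1 n * (2 + t_seq (Suc n) powr 1)"
      using Suc block_sum_pos[of 1 n] by (intro mult_mono) auto
    then show ?case by (simp add: block_sum_def mult.commute)
  qed (simp add: block_sum_def)
  then show ?thesis using of_nat_less_two_power[of n, where 'a = real] by linarith
qed

lemma ex_pt_ge: "\<exists>m. x \<le> pt m"
proof -
  obtain n where "x \<le> real n" using real_arch_simple by blast
  then have "x \<le> pt (3 ^ n)" using block_sum_1_ge[of n] by (simp add: pt_pow3)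
  then show ?thesis by blast
qed

lemma in_gapE_right:
  assumes "0 < x"
  obtains m where "pt m < x" "x \<le> pt (Suc m)"
proof -
  define k where "k = (LEAST k. x \<le> pt k)"
  have k: "x \<le> pt k" unfolding k_def using ex_pt_ge by (rule LeastI_ex)
  then have "k \<noteq> 0" using assms by (cases k) auto
  then obtain m where m: "k = Suc m" using not0_implies_Suc by blast
  have "\<not> x \<le> pt m" using not_less_Least[of m "\<lambda>k. x \<le> pt k"] m unfolding k_def by simp
  then show ?thesis using k unfolding m by (intro that[of m]) auto
qed

lemma in_gapE:
  assumes "0 \<le> x"
  obtains m where "pt m \<le> x" "x < pt (Suc m)"
proof -
  obtain k where "x + 1 \<le> pt k" using ex_pt_ge by blast
  then have ex: "\<exists>k. x < pt k" by (intro exI[of _ k]) simp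
  define k where "k = (LEAST k. x < pt k)"
  have k: "x < pt k" unfolding k_def using ex by (rule LeastI_ex)
  then have "k \<noteq> 0" using assms by (cases k) auto
  then obtain m where m: "k = Suc m" using not0_implies_Suc by blast
  have "\<not> x < pt m" using not_less_Least[of m "\<lambda>k. x < pt k"] m unfolding k_def by simp
  then show ?thesis using k unfolding m by (intro that[of m]) auto
qed

lemma pt_nonneg [simp]: "0 \<le> pt m"
  using pt_le_iff[of 0 m] by simp

lemma E_set_eq: "E_set = range pt \<union> range (\<lambda>m. - pt m)"
  unfolding E_set_def E_plus_eq by (auto simp: image_image)

lemma infdist_E_ge:
  assumes "\<And>e. e \<in> E_set \<Longrightarrow> r \<le> dist x e"
  shows "r \<le> infdist x E_set"
proof -
  have "E_set \<noteq> {}" by (simp add: E_set_eq)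
  then show ?thesis using assms by (simp add: infdist_notempty cINF_greatest)
qed

lemma E_set_disjoint_gap:
  assumes "e \<in> E_set"
  shows "e \<le> pt m \<or> pt (Suc m) \<le> e"
proof -
  consider k where "e = pt k" | k where "e = - pt k" using assms by (auto simp: E_set_eq)
  then show ?thesis
  proof cases
    case 1 then show ?thesis by (cases "k \<le> m") auto
  next
    case 2 then show ?thesis using pt_nonneg[of k] pt_nonneg[of m] by linarith
  qed
qed

lemma infdist_E_gap:
  assumes "pt m \<le> x" "x \<le> pt (Suc m)"
  shows "infdist x E_set = min (x - pt m) (pt (Suc m) - x)"
proof (rule antisym)
  have "pt m \<in> E_set" "pt (Suc m) \<in> E_set" by (auto simp: E_set_eq)
  then have "infdist x E_set \<le> dist x (pt m)" "infdist x E_set \<le> dist x (pt (Suc m))"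
    by (auto intro: infdist_le)
  then show "infdist x E_set \<le> min (x - pt m) (pt (Suc m) - x)"
    using assms by (simp add: dist_real_def)
  show "min (x - pt m) (pt (Suc m) - x) \<le> infdist x E_set"
    using E_set_disjoint_gap[of _ m] by (intro infdist_E_ge) (force simp: dist_real_def)
qed

lemma infdist_E_uminus: "infdist (- x) E_set = infdist x E_set"
proof -
  have *: "infdist x E_set \<le> infdist (- x) E_set" for x
  proof (rule infdist_E_ge)
    fix e assume "e \<in> E_set"
    then have "- e \<in> E_set" by (auto simp: E_set_eq)
    then show "infdist x E_set \<le> dist (- x) e"
      using infdist_le[of "- e" E_set x] by (simp add: dist_real_def abs_minus_commute)
  qed
  show ?thesis using *[of x] *[of "- x"] by simp
qed

lemma countable_E_set: "countable E_set"
  by (simp add: E_set_eq)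

lemma infdist_E_pos:
  assumes "x \<notin> E_set"
  shows "0 < infdist x E_set"
proof -
  have *: "0 < infdist y E_set" if y: "0 \<le> y" "y \<notin> E_set" for y
  proof -
    obtain m where m: "pt m \<le> y" "y < pt (Suc m)" using in_gapE[OF y(1)] by blast
    have "y \<noteq> pt m" using y by (auto simp: E_set_eq)
    then show ?thesis using m by (simp add: infdist_E_gap)
  qed
  show ?thesis
  proof (cases "0 \<le> x")
    case True then show ?thesis using * assms by blast
  next
    case False
    have "- x \<notin> E_set"
    proof
      assume "- x \<in> E_set"
      then have "- (- x) \<in> E_set" unfolding E_set_eq by (elim UnE rangeE) (auto simp: equation_minus_iff)
      with assms show False by simp
    qed
    then show ?thesis using *[of "- x"] False by (simp add: infdist_E_uminus)
  qed
qed

lemma AE_infdist_E_pos: "AE x in lborel. 0 < infdist x E_set"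
  using AE_not_in[OF countable_imp_null_set_lborel[OF countable_E_set]] infdist_E_pos
  by (auto elim: eventually_mono)

lemma borel_measurable_infdist_E [measurable]: "(\<lambda>x. infdist x E_set) \<in> borel_measurable borel"
  by (intro borel_measurable_continuous_onI continuous_intros)

section \<open>Integrals of powers of the distance\<close>

lemma nn_integral_powr_Icc0:
  assumes "-1 < s" "0 \<le> l"
  shows "(\<integral>\<^sup>+x\<in>{0..l}. ennreal (x powr s) \<partial>lborel) = ennreal (l powr (s + 1) / (s + 1))"
  using nn_integral_has_integral_lebesgue[OF _ has_integral_powr_from_0[OF assms]]
  by (simp add: mult.commute[of "indicator _ _"] ennreal_mult' ennreal_indicator)

lemma nn_integral_powr_right:
  assumes "-1 < s" "0 \<le> l"
  shows "(\<integral>\<^sup>+x\<in>{p..p + l}. ennreal (\<bar>x - p\<bar> powr s) \<partial>lborel) = ennreal (l powr (s + 1) / (s + 1))"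
proof -
  have "(\<integral>\<^sup>+x\<in>{p..p + l}. ennreal (\<bar>x - p\<bar> powr s) \<partial>lborel)
      = (\<integral>\<^sup>+x. ennreal (\<bar>p + 1 * x - p\<bar> powr s) * indicator {p..p + l} (p + 1 * x) \<partial>lborel)"
    by (subst nn_integral_real_affine[of _ 1 p]) auto
  also have "\<dots> = (\<integral>\<^sup>+x\<in>{0..l}. ennreal (x powr s) \<partial>lborel)"
    by (intro nn_integral_cong) (auto simp: indicator_def)
  finally show ?thesis using nn_integral_powr_Icc0[OF assms] by simp
qed

lemma nn_integral_powr_left:
  assumes "-1 < s" "0 \<le> l"
  shows "(\<integral>\<^sup>+x\<in>{p - l..p}. ennreal (\<bar>x - p\<bar> powr s) \<partial>lborel) = ennreal (l powr (s + 1) / (s + 1))"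
proof -
  have "(\<integral>\<^sup>+x\<in>{p - l..p}. ennreal (\<bar>x - p\<bar> powr s) \<partial>lborel)
      = (\<integral>\<^sup>+x. ennreal (\<bar>p + (-1) * x - p\<bar> powr s) * indicator {p - l..p} (p + (-1) * x) \<partial>lborel)"
    by (subst nn_integral_real_affine[of _ "-1" p]) auto
  also have "\<dots> = (\<integral>\<^sup>+x\<in>{0..l}. ennreal (x powr s) \<partial>lborel)"
    by (intro nn_integral_cong) (auto simp: indicator_def)
  finally show ?thesis using nn_integral_powr_Icc0[OF assms] by simp
qed

text \<open>For a negative exponent the position of the singularity \<open>p\<close> is irrelevant: points closer to \<open>p\<close>
  than \<open>l\<close> are covered by the two symmetric intervals at \<open>p\<close>, and at the others the integrand is
  at most \<open>l\<^bsup>-\<alpha>\<^esup>\<close>.\<close>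

lemma nn_integral_powr_interval_le:
  assumes "0 < \<alpha>" "\<alpha> < 1" "0 < l"
  shows "(\<integral>\<^sup>+x\<in>{a..<a + l}. ennreal (\<bar>x - p\<bar> powr (- \<alpha>)) \<partial>lborel)
    \<le> ennreal ((1 + 2 / (1 - \<alpha>)) * l powr (1 - \<alpha>))"
proof -
  let ?f = "\<lambda>x. ennreal (\<bar>x - p\<bar> powr (- \<alpha>))"
  have "?f x * indicator {a..<a + l} x \<le> ?f x * indicator {p..p + l} x
      + ?f x * indicator {p - l..p} x + ennreal (l powr - \<alpha>) * indicator {a..<a + l} x" for x
  proof (cases "x \<in> {p..p + l} \<union> {p - l..p}")
    case True then show ?thesis by (auto simp: indicator_def add_increasing2 add_increasing)
  next
    case False
    then have "l \<le> \<bar>x - p\<bar>" by auto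
    then have "\<bar>x - p\<bar> powr (- \<alpha>) \<le> l powr (- \<alpha>)"
      using assms by (intro powr_mono2') auto
    then show ?thesis by (auto simp: indicator_def intro!: add_increasing)
  qed
  then have "(\<integral>\<^sup>+x\<in>{a..<a + l}. ?f x \<partial>lborel) \<le> (\<integral>\<^sup>+x. ?f x * indicator {p..p + l} x
      + ?f x * indicator {p - l..p} x + ennreal (l powr - \<alpha>) * indicator {a..<a + l} x \<partial>lborel)"
    by (intro nn_integral_mono) auto
  also have "\<dots> = ennreal (l powr (1 - \<alpha>) / (1 - \<alpha>)) + ennreal (l powr (1 - \<alpha>) / (1 - \<alpha>))
      + ennreal (l powr (- \<alpha>)) * ennreal l"
    using nn_integral_powr_right[of "- \<alpha>" l p] nn_integral_powr_left[of "- \<alpha>" l p] assms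
    by (simp add: nn_integral_add nn_integral_cmult_indicator)
  also have "\<dots> = ennreal ((1 + 2 / (1 - \<alpha>)) * l powr (1 - \<alpha>))"
  proof -
    have "l powr (- \<alpha>) * l = l powr (1 - \<alpha>)"
      using assms powr_add[of l "- \<alpha>" 1] by simp
    then show ?thesis
      using assms by (simp add: ennreal_plus[symmetric] ennreal_mult'[symmetric] algebra_simps
          del: ennreal_plus)
  qed
  finally show ?thesis .
qed

text \<open>Here the integrand is real-valued, so for \<open>s < 0\<close> it is \<open>0\<close> rather than infinite on the set;
  as the set is countable this does not affect the integral.\<close>

definition dist_integral :: "real \<Rightarrow> real set \<Rightarrow> ennreal" where
  "dist_integral s Q = (\<integral>\<^sup>+x\<in>Q. ennreal (infdist x E_set powr s) \<partial>lborel)"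

lemma dist_integral_mono: "P \<subseteq> Q \<Longrightarrow> dist_integral s P \<le> dist_integral s Q"
  unfolding dist_integral_def by (intro nn_integral_mono) (auto simp: indicator_def)

lemma dist_integral_split:
  assumes "a \<le> b" "b \<le> c"
  shows "dist_integral s {a..<c} = dist_integral s {a..<b} + dist_integral s {b..<c}"
proof -
  have "dist_integral s {a..<c} = (\<integral>\<^sup>+x. ennreal (infdist x E_set powr s) * indicator {a..<b} x
      + ennreal (infdist x E_set powr s) * indicator {b..<c} x \<partial>lborel)"
    unfolding dist_integral_def using assms by (intro nn_integral_cong) (auto simp: indicator_def)
  also have "\<dots> = dist_integral s {a..<b} + dist_integral s {b..<c}"
    unfolding dist_integral_def by (subst nn_integral_add) auto
  finally show ?thesis .
qed

lemma dist_integral_uminus: "dist_integral s {- b..<- a} = dist_integral s {a..<b}"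
proof -
  have "dist_integral s {- b..<- a} = (\<integral>\<^sup>+x. ennreal (infdist (0 + (-1) * x) E_set powr s)
      * indicator {- b..<- a} (0 + (-1) * x) \<partial>lborel)"
    unfolding dist_integral_def by (subst nn_integral_real_affine[of _ "-1" 0]) auto
  also have "\<dots> = dist_integral s {a..<b}"
    unfolding dist_integral_def
  proof (rule nn_integral_cong_AE)
    have "AE x in lborel. x \<noteq> a \<and> x \<noteq> b"
      using AE_lborel_singleton[of a] AE_lborel_singleton[of b] by eventually_elim auto
    then show "AE x in lborel. ennreal (infdist (0 + (-1) * x) E_set powr s)
        * indicator {- b..<- a} (0 + (-1) * x)
        = ennreal (infdist x E_set powr s) * indicator {a..<b} x"
      by eventually_elim (auto simp: indicator_def infdist_E_uminus)
  qed
  finally show ?thesis .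
qed

text \<open>On a gap the distance equals the distance to one of the two endpoints, so its power is at most
  the sum of the two powers, whatever the sign of \<open>s\<close>.\<close>

lemma dist_integral_gap:
  assumes "-1 < s"
  shows "dist_integral s {pt m..<pt (Suc m)} \<le> ennreal (2 / (s + 1) * gap 0 m powr (1 + s))"
proof -
  let ?g = "gap 0 m"
  let ?f = "\<lambda>p x. ennreal (\<bar>x - p\<bar> powr s)"
  have "dist_integral s {pt m..<pt (Suc m)} \<le> (\<integral>\<^sup>+x. ?f (pt m) x * indicator {pt m..pt m + ?g} x
      + ?f (pt (Suc m)) x * indicator {pt (Suc m) - ?g..pt (Suc m)} x \<partial>lborel)"
    unfolding dist_integral_def
    by (intro nn_integral_mono) (auto simp: indicator_def infdist_E_gap pt_Suc min_def)
  also have "\<dots> = ennreal (?g powr (s + 1) / (s + 1)) + ennreal (?g powr (s + 1) / (s + 1))"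
    using nn_integral_powr_right[OF assms, of ?g "pt m"]
      nn_integral_powr_left[OF assms, of ?g "pt (Suc m)"] gap_pos[of 0 m]
    by (subst nn_integral_add) (auto simp: less_imp_le)
  also have "\<dots> = ennreal (2 / (s + 1) * ?g powr (1 + s))"
    using assms by (simp add: ennreal_plus[symmetric] add.commute del: ennreal_plus)
  finally show ?thesis .
qed

lemma dist_integral_gaps:
  assumes "-1 < s" "i \<le> j"
  shows "dist_integral s {pt i..<pt (Suc j)} \<le> ennreal (2 / (s + 1) * (\<Sum>m = i..j. gap 0 m powr (1 + s)))"
  using assms(2)
proof (induction j rule: dec_induct)
  case base
  then show ?case using dist_integral_gap[OF assms(1)] by simp
next
  case (step j)
  have "dist_integral s {pt i..<pt (Suc (Suc j))}
      = dist_integral s {pt i..<pt (Suc j)} + dist_integral s {pt (Suc j)..<pt (Suc (Suc j))}"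
    using step by (intro dist_integral_split) auto
  also have "\<dots> \<le> ennreal (2 / (s + 1) * (\<Sum>m = i..j. gap 0 m powr (1 + s)))
      + ennreal (2 / (s + 1) * gap 0 (Suc j) powr (1 + s))"
    by (intro add_mono step dist_integral_gap assms)
  also have "\<dots> = ennreal (2 / (s + 1) * (\<Sum>m = i..Suc j. gap 0 m powr (1 + s)))"
    using step assms by (simp add: ennreal_plus[symmetric] sum_nonneg distrib_left del: ennreal_plus)
  finally show ?case .
qed

lemma dist_integral_le_sup:
  assumes "0 \<le> M" "a \<le> b" "\<And>x. x \<in> {a..<b} \<Longrightarrow> infdist x E_set powr s \<le> M"
  shows "dist_integral s {a..<b} \<le> ennreal (M * (b - a))"
proof -
  have "dist_integral s {a..<b} \<le> (\<integral>\<^sup>+x. ennreal M * indicator {a..<b} x \<partial>lborel)"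
    unfolding dist_integral_def using assms(3)
    by (intro nn_integral_mono) (auto simp: indicator_def intro: ennreal_leI)
  also have "\<dots> = ennreal (M * (b - a))"
    using assms(1,2) by (simp add: nn_integral_cmult_indicator ennreal_mult')
  finally show ?thesis .
qed

lemma pt_diff: "i \<le> j \<Longrightarrow> pt (Suc j) - pt i = (\<Sum>m = i..j. gap 0 m)"
  by (induction j rule: dec_induct) (auto simp: pt_Suc)

text \<open>The natural scale is \<open>M = dist(a, E) + l\<close>, with \<open>l\<close> the length of the interval: the distance is
  at most \<open>M\<close>, and the average of its power \<open>-\<alpha>\<close> is at most a multiple of \<open>M\<^bsup>-\<alpha>\<^esup>\<close>. If the interval
  is far from \<open>E\<close> relative to \<open>l\<close>, the latter holds pointwise, as the distance is
  \<open>1\<close>-Lipschitz; otherwise \<open>M\<close> is comparable to \<open>l\<close>, and only three points of \<open>E\<close> matter.\<close>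

lemma dist_integral_product_two_gaps:
  fixes \<alpha> \<beta> a b :: real
  assumes \<alpha>: "0 < \<alpha>" "\<alpha> < 1" and \<beta>: "0 < \<beta>" and ab: "a < b"
    and i: "pt i \<le> a" "b \<le> pt (Suc (Suc i))"
  shows "\<exists>X Y. 0 \<le> X \<and> 0 \<le> Y \<and> dist_integral (- \<alpha>) {a..<b} \<le> ennreal (X * (b - a))
    \<and> dist_integral \<beta> {a..<b} \<le> ennreal (Y * (b - a))
    \<and> X * Y powr (\<alpha> / \<beta>) \<le> 9 * (1 + 2 / (1 - \<alpha>))"
proof -
  define l where "l = b - a"
  define K where "K = 1 + 2 / (1 - \<alpha>)"
  define M where "M = infdist a E_set + l"
  have l: "0 < l" using ab by (simp add: l_def)
  have K: "1 \<le> K" using \<alpha> by (simp add: K_def)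
  have M: "0 < M" using l infdist_nonneg[of a E_set] by (simp add: M_def)
  have lip: "infdist x E_set \<le> infdist a E_set + l" "infdist a E_set \<le> infdist x E_set + l"
    if "x \<in> {a..<b}" for x
    using infdist_triangle[of x E_set a] infdist_triangle[of a E_set x] that
    by (auto simp: dist_real_def l_def)
  have 3: "3 powr \<alpha> * M powr - \<alpha> \<le> 3 * M powr - \<alpha>"
    using \<alpha> powr_mono[of \<alpha> 1 "3::real"] by (intro mult_right_mono) auto
  have "dist_integral \<beta> {a..<b} \<le> ennreal (M powr \<beta> * (b - a))"
    using \<beta> ab lip by (intro dist_integral_le_sup) (auto simp: M_def infdist_nonneg intro!: powr_mono2)
  moreover have "dist_integral (- \<alpha>) {a..<b} \<le> ennreal (9 * K * M powr - \<alpha> * (b - a))"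
  proof (cases "2 * l \<le> infdist a E_set")
    case True
    have "infdist x E_set powr - \<alpha> \<le> 9 * K * M powr - \<alpha>" if x: "x \<in> {a..<b}" for x
    proof -
      have "infdist x E_set powr - \<alpha> \<le> (M / 3) powr - \<alpha>"
        using lip(2)[OF x] M \<alpha> True by (intro powr_mono2') (auto simp: M_def)
      also have "\<dots> = 3 powr \<alpha> * M powr - \<alpha>"
        using M by (simp add: powr_divide powr_minus field_simps)
      also have "\<dots> \<le> 3 * M powr - \<alpha>" by (rule 3)
      also have "\<dots> \<le> 9 * K * M powr - \<alpha>" using K by (intro mult_right_mono) auto
      finally show ?thesis .
    qed
    then show ?thesis using ab K by (intro dist_integral_le_sup) auto
  next
    case False
    let ?f = "\<lambda>p x. ennreal (\<bar>x - p\<bar> powr - \<alpha>) * indicator {a..<a + l} x"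
    have "dist_integral (- \<alpha>) {a..<b}
        \<le> (\<integral>\<^sup>+x. ?f (pt i) x + ?f (pt (Suc i)) x + ?f (pt (Suc (Suc i))) x \<partial>lborel)"
      unfolding dist_integral_def
    proof (intro nn_integral_mono)
      fix x :: real
      show "ennreal (infdist x E_set powr - \<alpha>) * indicator {a..<b} x
          \<le> ?f (pt i) x + ?f (pt (Suc i)) x + ?f (pt (Suc (Suc i))) x"
      proof (cases "x \<in> {a..<b}")
        case True
        then have "infdist x E_set \<in> {\<bar>x - pt i\<bar>, \<bar>x - pt (Suc i)\<bar>, \<bar>x - pt (Suc (Suc i))\<bar>}"
          using i infdist_E_gap[of i x] infdist_E_gap[of "Suc i" x]
          by (cases "x \<le> pt (Suc i)") (auto simp: min_def)
        then show ?thesis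
          using True by (auto simp: l_def add_increasing add_increasing2)
      qed auto
    qed
    also have "\<dots> = (\<integral>\<^sup>+x. ?f (pt i) x \<partial>lborel) + (\<integral>\<^sup>+x. ?f (pt (Suc i)) x \<partial>lborel)
        + (\<integral>\<^sup>+x. ?f (pt (Suc (Suc i))) x \<partial>lborel)"
      by (simp add: nn_integral_add)
    also have "\<dots> \<le> ennreal (K * l powr (1 - \<alpha>)) + ennreal (K * l powr (1 - \<alpha>))
        + ennreal (K * l powr (1 - \<alpha>))"
      unfolding K_def using \<alpha> l by (intro add_mono nn_integral_powr_interval_le)
    also have "\<dots> = ennreal (3 * (K * l powr (1 - \<alpha>)))"
      using K by (simp add: ennreal_plus[symmetric] del: ennreal_plus)
    also have "\<dots> \<le> ennreal (9 * K * M powr - \<alpha> * (b - a))"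
    proof (rule ennreal_leI)
      have "l powr - \<alpha> \<le> (M / 3) powr - \<alpha>"
        using False M \<alpha> l by (intro powr_mono2') (auto simp: M_def)
      also have "\<dots> = 3 powr \<alpha> * M powr - \<alpha>"
        using M by (simp add: powr_divide powr_minus field_simps)
      also have "\<dots> \<le> 3 * M powr - \<alpha>" by (rule 3)
      finally have "l powr - \<alpha> \<le> 3 * M powr - \<alpha>" .
      then have "3 * K * (l powr - \<alpha> * l) \<le> 3 * K * (3 * M powr - \<alpha> * l)"
        using K l by (intro mult_left_mono mult_right_mono) auto
      moreover have "l powr - \<alpha> * l = l powr (1 - \<alpha>)"
        using l powr_add[of l "- \<alpha>" 1] by simp
      ultimately show "3 * (K * l powr (1 - \<alpha>)) \<le> 9 * K * M powr - \<alpha> * (b - a)"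
        unfolding l_def by (simp only: mult.assoc mult.left_commute)
    qed
    finally show ?thesis .
  qed
  moreover have "9 * K * M powr - \<alpha> * (M powr \<beta>) powr (\<alpha> / \<beta>) \<le> 9 * K"
    using \<beta> M by (simp add: powr_powr powr_minus)
  ultimately show ?thesis using K by (intro exI[of _ "9 * K * M powr - \<alpha>"] exI[of _ "M powr \<beta>"]) (auto simp: K_def)
qed

text \<open>Long intervals are enlarged to the union of the gaps that they meet. This multiplies the length
  by at most \<open>5\<close>, since the two outermost gaps are at most twice as long as their inner
  neighbours, which lie in the interval.\<close>

lemma dist_integral_product_nonneg:
  fixes \<alpha> \<beta> :: real
  assumes \<alpha>: "0 < \<alpha>" "\<alpha> < 1" and \<beta>: "0 < \<beta>"
  obtains C where "0 < C" "\<And>a b. 0 \<le> a \<Longrightarrow> a < b \<Longrightarrow>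
    \<exists>X Y. 0 \<le> X \<and> 0 \<le> Y \<and> dist_integral (- \<alpha>) {a..<b} \<le> ennreal (X * (b - a))
      \<and> dist_integral \<beta> {a..<b} \<le> ennreal (Y * (b - a)) \<and> X * Y powr (\<alpha> / \<beta>) \<le> C"
proof -
  define \<gamma> where "\<gamma> = \<alpha> / \<beta>"
  have \<gamma>: "0 < \<gamma>" using \<alpha> \<beta> by (simp add: \<gamma>_def)
  obtain C where C: "0 < C" "\<And>i j. i \<le> j \<Longrightarrow>
    (\<Sum>m = i..j. gap 0 m powr (1 - \<alpha>)) * (\<Sum>m = i..j. gap 0 m powr (1 + \<beta>)) powr \<gamma>
      \<le> C * (\<Sum>m = i..j. gap 0 m) powr (1 + \<gamma>)"
    using sum_gap_comparison[OF \<alpha> \<beta>] unfolding \<gamma>_def by blast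
  define A B where "A = 2 / (1 - \<alpha>)" and "B = 2 / (1 + \<beta>)"
  have AB: "0 < A" "0 < B" using \<alpha> \<beta> by (auto simp: A_def B_def)
  define C' where "C' = A * B powr \<gamma> * (C * 5 powr (1 + \<gamma>))"
  define C'' where "C'' = max C' (9 * (1 + 2 / (1 - \<alpha>)))"
  have "0 < C''" using \<alpha> by (simp add: C''_def less_max_iff_disj add_pos_nonneg)
  moreover have "\<exists>X Y. 0 \<le> X \<and> 0 \<le> Y \<and> dist_integral (- \<alpha>) {a..<b} \<le> ennreal (X * (b - a))
      \<and> dist_integral \<beta> {a..<b} \<le> ennreal (Y * (b - a)) \<and> X * Y powr (\<alpha> / \<beta>) \<le> C''"
    if ab: "0 \<le> a" "a < b" for a b
  proof -
    obtain i where i: "pt i \<le> a" "a < pt (Suc i)" using in_gapE[OF ab(1)] by blast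
    obtain j where j: "pt j < b" "b \<le> pt (Suc j)" using in_gapE_right[of b] ab by auto
    show ?thesis
    proof (cases "j \<le> Suc i")
      case True
      then have "pt (Suc j) \<le> pt (Suc (Suc i))" by simp
      then have "b \<le> pt (Suc (Suc i))" using j(2) by (rule order_trans[rotated])
      from dist_integral_product_two_gaps[OF \<alpha> \<beta> ab(2) i(1) this] show ?thesis
        unfolding C''_def by (meson max.coboundedI2)
    next
      case False
      define l where "l = b - a"
      have l: "0 < l" using ab by (simp add: l_def)
      define S where "S s = (\<Sum>m = i..j. gap 0 m powr (1 + s))" for s
      have S: "0 \<le> S s" for s by (simp add: S_def sum_nonneg)
      have inner: "pt j - pt (Suc i) < l" using i j by (simp add: l_def)
      have "gap 0 (Suc i) \<le> pt j - pt (Suc i)"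
        using False pt_le_iff[of "Suc (Suc i)" j] by (simp add: pt_Suc)
      then have gi: "gap 0 i \<le> 2 * l" using gap_adjacent(2)[of 0 i] inner by linarith
      obtain j' where j': "j = Suc j'" using False by (cases j) auto
      then have "gap 0 j' \<le> pt j - pt (Suc i)"
        using False pt_le_iff[of "Suc i" j'] by (simp add: pt_Suc)
      then have gj: "gap 0 j \<le> 2 * l" using gap_adjacent(1)[of 0 j'] inner j' by simp
      have "(\<Sum>m = i..j. gap 0 m) = pt (Suc j) - pt i"
        using False by (intro pt_diff[symmetric]) auto
      also have "\<dots> = gap 0 i + (pt j - pt (Suc i)) + gap 0 j" by (simp add: pt_Suc)
      finally have len: "(\<Sum>m = i..j. gap 0 m) \<le> 5 * l" using inner gi gj by linarith
      have sub: "{a..<b} \<subseteq> {pt i..<pt (Suc j)}" using i j by auto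
      have bnd: "dist_integral s {a..<b} \<le> ennreal (2 / (s + 1) * S s / l * (b - a))" if "-1 < s" for s
      proof -
        have "dist_integral s {a..<b} \<le> ennreal (2 / (s + 1) * S s)"
          unfolding S_def using that False
          by (intro order_trans[OF dist_integral_mono[OF sub]] dist_integral_gaps) auto
        then show ?thesis using l by (simp add: l_def[symmetric])
      qed
      have "(A * S (- \<alpha>) / l) * (B * S \<beta> / l) powr \<gamma>
          = A * B powr \<gamma> * (S (- \<alpha>) * S \<beta> powr \<gamma>) / l powr (1 + \<gamma>)"
        using AB S l by (simp add: powr_mult powr_divide powr_add)
      also have "\<dots> \<le> A * B powr \<gamma> * (C * (5 * l) powr (1 + \<gamma>)) / l powr (1 + \<gamma>)"
      proof -
        have "S (- \<alpha>) * S \<beta> powr \<gamma> \<le> C * (\<Sum>m = i..j. gap 0 m) powr (1 + \<gamma>)"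
          using C(2)[of i j] False unfolding S_def by simp
        also have "\<dots> \<le> C * (5 * l) powr (1 + \<gamma>)"
          using C(1) \<gamma> len by (intro mult_left_mono powr_mono2) (auto intro!: sum_nonneg simp: gap_pos less_imp_le)
        finally show ?thesis
          using AB l by (intro divide_right_mono mult_left_mono) auto
      qed
      also have "\<dots> = C'" using l by (simp add: powr_mult C'_def)
      also have "\<dots> \<le> C''" by (simp add: C''_def)
      finally have "(A * S (- \<alpha>) / l) * (B * S \<beta> / l) powr \<gamma> \<le> C''" .
      moreover have "dist_integral (- \<alpha>) {a..<b} \<le> ennreal (A * S (- \<alpha>) / l * (b - a))"
        using bnd[of "- \<alpha>"] \<alpha> by (simp add: A_def)
      moreover have "dist_integral \<beta> {a..<b} \<le> ennreal (B * S \<beta> / l * (b - a))"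
        using bnd[of \<beta>] \<beta> by (simp add: B_def add.commute)
      ultimately show ?thesis
        using AB S l unfolding \<gamma>_def
        by (intro exI[of _ "A * S (- \<alpha>) / l"] exI[of _ "B * S \<beta> / l"]) auto
    qed
  qed
  ultimately show ?thesis using that by blast
qed

text \<open>Symmetry of \<open>E\<close> reduces an interval of negative numbers to its mirror image, and an interval
  around \<open>0\<close> to the longer of its two halves. The bounds \<open>X\<close> and \<open>Y\<close> on the two averages stay
  real numbers here, so that the estimate is free of infinite values.\<close>

lemma dist_integral_product:
  fixes \<alpha> \<beta> :: real
  assumes \<alpha>: "0 < \<alpha>" "\<alpha> < 1" and \<beta>: "0 < \<beta>"
  shows "\<exists>C. \<forall>a b. a < b \<longrightarrow>
    (\<exists>X Y. 0 \<le> X \<and> 0 \<le> Y \<and> dist_integral (- \<alpha>) {a..<b} \<le> ennreal (X * (b - a))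
      \<and> dist_integral \<beta> {a..<b} \<le> ennreal (Y * (b - a)) \<and> X * Y powr (\<alpha> / \<beta>) \<le> C)"
proof -
  define \<gamma> where "\<gamma> = \<alpha> / \<beta>"
  have \<gamma>: "0 < \<gamma>" using \<alpha> \<beta> by (simp add: \<gamma>_def)
  obtain C where C: "0 < C" "\<And>a b. 0 \<le> a \<Longrightarrow> a < b \<Longrightarrow>
    \<exists>X Y. 0 \<le> X \<and> 0 \<le> Y \<and> dist_integral (- \<alpha>) {a..<b} \<le> ennreal (X * (b - a))
      \<and> dist_integral \<beta> {a..<b} \<le> ennreal (Y * (b - a)) \<and> X * Y powr \<gamma> \<le> C"
    using dist_integral_product_nonneg[OF assms] unfolding \<gamma>_def by blast
  define C' where "C' = 2 powr (1 + \<gamma>) * C"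
  have C': "C \<le> C'" using C(1) \<gamma> ge_one_powr_ge_zero[of 2 "1 + \<gamma>"] by (auto simp: C'_def)
  have "\<exists>X Y. 0 \<le> X \<and> 0 \<le> Y \<and> dist_integral (- \<alpha>) {a..<b} \<le> ennreal (X * (b - a))
      \<and> dist_integral \<beta> {a..<b} \<le> ennreal (Y * (b - a)) \<and> X * Y powr \<gamma> \<le> C'"
    if ab: "a < b" for a b
  proof -
    consider "0 \<le> a" | "b \<le> 0" | "a < 0" "0 < b" by linarith
    then show ?thesis
    proof cases
      case 1
      then show ?thesis using C(2)[OF 1 ab] C' by (meson order_trans)
    next
      case 2
      then have "0 \<le> - b" "- b < - a" using ab by auto
      from C(2)[OF this] show ?thesis
        unfolding dist_integral_uminus using C' by (auto intro: order_trans)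
    next
      case 3
      define c where "c = max (- a) b"
      have c: "0 < c" "c \<le> b - a" "- c \<le> a" "b \<le> c" using 3 by (auto simp: c_def)
      obtain X Y where XY: "0 \<le> X" "0 \<le> Y" "dist_integral (- \<alpha>) {0..<c} \<le> ennreal (X * (c - 0))"
        "dist_integral \<beta> {0..<c} \<le> ennreal (Y * (c - 0))" "X * Y powr \<gamma> \<le> C"
        using C(2)[of 0 c] c by auto
      have dbl: "dist_integral s {a..<b} \<le> ennreal (2 * Z * (b - a))"
        if Z: "0 \<le> Z" "dist_integral s {0..<c} \<le> ennreal (Z * (c - 0))" for s Z
      proof -
        have "dist_integral s {a..<b} \<le> dist_integral s {- c..<c}"
          using c by (intro dist_integral_mono) auto
        also have "\<dots> = dist_integral s {- c..<- 0} + dist_integral s {0..<c}"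
          using c dist_integral_split[of "- c" 0 c s] by simp
        also have "\<dots> \<le> ennreal (Z * c) + ennreal (Z * c)"
          unfolding dist_integral_uminus using Z by (intro add_mono) auto
        also have "\<dots> = ennreal (2 * Z * c)"
          using Z c by (simp add: ennreal_plus[symmetric] del: ennreal_plus)
        also have "\<dots> \<le> ennreal (2 * Z * (b - a))"
          using Z c by (intro ennreal_leI mult_left_mono) auto
        finally show ?thesis .
      qed
      have "2 * X * (2 * Y) powr \<gamma> = 2 powr (1 + \<gamma>) * (X * Y powr \<gamma>)"
        using XY by (simp add: powr_mult powr_add)
      also have "\<dots> \<le> C'" unfolding C'_def using XY by (intro mult_left_mono) auto
      finally show ?thesis
        using dbl[OF XY(1,3)] dbl[OF XY(2,4)] XY(1,2)
        by (intro exI[of _ "2 * X"] exI[of _ "2 * Y"]) auto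
    qed
  qed
  then show ?thesis unfolding \<gamma>_def by blast
qed

section \<open>Membership in the Muckenhoupt classes\<close>

lemma dist_weight_eq:
  assumes "0 < infdist x E_set"
  shows "dist_weight E_set \<alpha> x = ennreal (infdist x E_set powr - \<alpha>)"
  using assms by (simp add: dist_weight_def epowr_def)

lemma dist_weight_ge:
  assumes "0 < \<alpha>" "0 < r" "infdist x E_set \<le> r"
  shows "ennreal (r powr - \<alpha>) \<le> dist_weight E_set \<alpha> x"
proof (cases "infdist x E_set = 0")
  case True
  then show ?thesis using assms by (simp add: dist_weight_def epowr_def)
next
  case False
  then have "0 < infdist x E_set" using infdist_nonneg[of x E_set] by simp
  then show ?thesis using assms by (simp add: dist_weight_eq powr_mono2')
qed

lemma nn_integral_dist_weight:
  "(\<integral>\<^sup>+x\<in>Q. dist_weight E_set \<alpha> x \<partial>lebesgue) = dist_integral (- \<alpha>) Q"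
  unfolding dist_integral_def nn_integral_completion
  using AE_infdist_E_pos by (intro nn_integral_cong_AE) (auto simp: dist_weight_eq elim: eventually_mono)

lemma epowr_dist_weight:
  assumes "0 < \<alpha>" "1 < p"
  shows "epowr (dist_weight E_set \<alpha> x) (1 / (1 - p)) = ennreal (infdist x E_set powr (\<alpha> / (p - 1)))"
proof (cases "infdist x E_set = 0")
  case True
  then show ?thesis using assms by (simp add: dist_weight_def epowr_def)
next
  case False
  then have pos: "0 < infdist x E_set" using infdist_nonneg[of x E_set] by simp
  have "- \<alpha> * (1 / (1 - p)) = \<alpha> / (p - 1)" using assms by (simp add: field_simps)
  then show ?thesis
    using pos assms by (simp add: dist_weight_eq) (simp add: epowr_def powr_powr)
qed

lemma is_cube_Ico: "a < b \<Longrightarrow> is_cube {a..<b}"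
  unfolding is_cube_def by blast

lemma average_le:
  assumes "a < b" "0 \<le> X" "(\<integral>\<^sup>+x\<in>{a..<b}. f x \<partial>lebesgue) \<le> ennreal (X * (b - a))"
  shows "average {a..<b} f \<le> ennreal X"
proof -
  have "average {a..<b} f \<le> ennreal (X * (b - a)) / ennreal (b - a)"
    using divide_right_mono_ennreal[OF assms(3)] assms(1) by (simp add: average_def)
  also have "\<dots> = ennreal X" using assms by (simp add: divide_ennreal)
  finally show ?thesis .
qed

lemma epowr_le:
  assumes "0 < c" "0 \<le> Y" "y \<le> ennreal Y"
  shows "epowr y c \<le> ennreal (Y powr c)"
proof -
  obtain z where z: "y = ennreal z" "0 \<le> z"
    using assms(3) by (cases y) (auto simp: top_unique)
  then have "z \<le> Y" using assms by simp
  then have "z powr c \<le> Y powr c" using z assms by (intro powr_mono2) auto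
  then show ?thesis using assms z by (auto simp: epowr_def ennreal_leI)
qed

lemma weight_dist_weight:
  assumes \<alpha>: "0 < \<alpha>" "\<alpha> < 1"
  shows "weight (dist_weight E_set \<alpha>)"
  unfolding weight_def
proof (intro conjI allI impI)
  have "dist_weight E_set \<alpha> \<in> borel_measurable borel"
    unfolding dist_weight_def epowr_def by measurable
  then show "dist_weight E_set \<alpha> \<in> borel_measurable lebesgue"
    by (simp add: measurable_completion)
  show "AE x in lebesgue. 0 < dist_weight E_set \<alpha> x"
    using AE_completion[OF AE_infdist_E_pos] by (rule eventually_mono) (simp add: dist_weight_eq)
  fix K :: "real set" assume "compact K"
  then obtain M where M: "0 < M" "\<And>x. x \<in> K \<Longrightarrow> norm x \<le> M"
    using compact_imp_bounded bounded_pos by metis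
  have "- M < M + 1" using M(1) by simp
  then obtain X where "dist_integral (- \<alpha>) {- M..<M + 1} \<le> ennreal (X * (M + 1 - - M))"
    using dist_integral_product[OF \<alpha> zero_less_one] by blast
  moreover have "dist_integral (- \<alpha>) K \<le> dist_integral (- \<alpha>) {- M..<M + 1}"
    using M by (intro dist_integral_mono) (force simp: abs_le_iff)
  ultimately show "(\<integral>\<^sup>+x\<in>K. dist_weight E_set \<alpha> x \<partial>lebesgue) < \<infinity>"
    unfolding nn_integral_dist_weight infinity_ennreal_def
    by (meson ennreal_less_top le_less_trans)
qed

lemma dist_weight_in_A_p:
  assumes \<alpha>: "0 < \<alpha>" "\<alpha> < 1" and p: "1 < p"
  shows "dist_weight E_set \<alpha> \<in> A_p p"
proof -
  define \<beta> where "\<beta> = \<alpha> / (p - 1)"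
  have \<beta>: "0 < \<beta>" "\<alpha> / \<beta> = p - 1" using \<alpha> p by (auto simp: \<beta>_def)
  obtain C where C: "\<forall>a b. a < b \<longrightarrow> (\<exists>X Y. 0 \<le> X \<and> 0 \<le> Y \<and>
      dist_integral (- \<alpha>) {a..<b} \<le> ennreal (X * (b - a))
      \<and> dist_integral \<beta> {a..<b} \<le> ennreal (Y * (b - a)) \<and> X * Y powr (p - 1) \<le> C)"
    by (rule exE[OF dist_integral_product[OF \<alpha> \<beta>(1), unfolded \<beta>(2)]])
  have "average Q (dist_weight E_set \<alpha>)
      * epowr (average Q (\<lambda>x. epowr (dist_weight E_set \<alpha> x) (1 / (1 - p)))) (p - 1) \<le> ennreal C"
    if Q: "is_cube Q" for Q
  proof -
    obtain a b where ab: "a < b" "Q = {a..<b}" using Q unfolding is_cube_def by blast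
    obtain X Y where XY: "0 \<le> X" "0 \<le> Y" "dist_integral (- \<alpha>) {a..<b} \<le> ennreal (X * (b - a))"
      "dist_integral \<beta> {a..<b} \<le> ennreal (Y * (b - a))" "X * Y powr (p - 1) \<le> C"
      using C ab(1) by blast
    have "average Q (dist_weight E_set \<alpha>) \<le> ennreal X"
      unfolding ab(2) using ab XY by (intro average_le) (auto simp: nn_integral_dist_weight)
    moreover have "average Q (\<lambda>x. epowr (dist_weight E_set \<alpha> x) (1 / (1 - p))) \<le> ennreal Y"
      unfolding ab(2) epowr_dist_weight[OF \<alpha>(1) p] \<beta>_def[symmetric] using ab XY
      by (intro average_le) (auto simp: nn_integral_completion dist_integral_def)
    ultimately have "average Q (dist_weight E_set \<alpha>)
        * epowr (average Q (\<lambda>x. epowr (dist_weight E_set \<alpha> x) (1 / (1 - p)))) (p - 1)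
        \<le> ennreal X * ennreal (Y powr (p - 1))"
      using XY p by (intro mult_mono epowr_le) auto
    also have "\<dots> = ennreal (X * Y powr (p - 1))" using XY by (simp add: ennreal_mult')
    also have "\<dots> \<le> ennreal C" by (rule ennreal_leI[OF XY(5)])
    finally show ?thesis .
  qed
  then show ?thesis unfolding A_p_def using weight_dist_weight[OF \<alpha>] by blast
qed

section \<open>Density of neighbourhoods of the set\<close>

lemma lmeasurable_Ico [simp]: "{a..<b::real} \<in> lmeasurable"
  by (rule fmeasurableI; cases "a \<le> b") auto

lemma far_sets [simp]: "{x. r \<le> infdist x E_set} \<in> sets lebesgue"
proof -
  have "{x. r \<le> infdist x E_set} \<in> sets borel" by measurable
  then show ?thesis by simp
qed

text \<open>Markov's inequality for the distance itself: its integral over the first \<open>3\<^sup>n\<close> gaps is bounded by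
  the sum of the squared gap lengths, which is negligible against the sum of the gap lengths.\<close>

lemma far_points_negligible:
  assumes r: "0 < r" and \<epsilon>: "0 < \<epsilon>"
  obtains n where "measure lebesgue ({0..<pt (3 ^ n)} \<inter> {x. r \<le> infdist x E_set}) \<le> \<epsilon> * pt (3 ^ n)"
proof -
  obtain n where n: "block_sum 2 n \<le> (\<epsilon> * r) * block_sum 1 n"
    using block_sum_square_negligible[of "\<epsilon> * r"] r \<epsilon> by auto
  define L where "L = pt (3 ^ n)"
  define S where "S = {0..<L} \<inter> {x. r \<le> infdist x E_set}"
  obtain j where j: "3 ^ n = Suc j" using not0_implies_Suc[of "3 ^ n"] by auto
  have "{0..j} = {3 ^ n * 0..<3 ^ n * Suc 0}" using j by auto
  then have sum: "(\<Sum>m = 0..j. gap 0 m powr (1 + 1)) = block_sum 2 n"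
    using sum_gap_block[where n = n and q = 0 and s = 2] by (simp del: mult_Suc_right)
  have dint: "dist_integral 1 {0..<L} \<le> ennreal (block_sum 2 n)"
    using dist_integral_gaps[of 1 0 j] j sum by (simp add: L_def)
  have "emeasure lborel S = emeasure lborel {x \<in> {0..<L}. 1 \<le> ennreal (1 / r) * ennreal (infdist x E_set)}"
  proof -
    have "1 \<le> ennreal (1 / r) * ennreal (infdist x E_set) \<longleftrightarrow> r \<le> infdist x E_set" for x
      using r by (simp add: ennreal_mult'[symmetric] ennreal_1[symmetric] infdist_nonneg field_simps del: ennreal_1)
    then show ?thesis by (auto simp: S_def intro!: arg_cong2[where f = emeasure])
  qed
  also have "\<dots> \<le> ennreal (1 / r) * (\<integral>\<^sup>+x\<in>{0..<L}. ennreal (infdist x E_set) \<partial>lborel)"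
    by (intro nn_integral_Markov_inequality) auto
  also have "(\<integral>\<^sup>+x\<in>{0..<L}. ennreal (infdist x E_set) \<partial>lborel) = dist_integral 1 {0..<L}"
    by (simp add: dist_integral_def infdist_nonneg)
  also have "ennreal (1 / r) * \<dots> \<le> ennreal (1 / r) * ennreal ((\<epsilon> * r) * block_sum 1 n)"
    using dint n by (intro mult_left_mono) (auto intro: order_trans ennreal_leI)
  also have "\<dots> = ennreal (\<epsilon> * L)"
    using r \<epsilon> block_sum_pos[of 1 n] by (simp add: ennreal_mult'[symmetric] L_def pt_pow3)
  finally have "emeasure lborel S \<le> ennreal (\<epsilon> * L)" .
  moreover have "measure lebesgue S = measure lborel S"
  proof -
    have "S \<in> sets borel" unfolding S_def by measurable
    then show ?thesis by (simp add: measure_completion)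
  qed
  ultimately have "measure lebesgue S \<le> \<epsilon> * L"
    using \<epsilon> by (simp add: measure_def enn2real_leI L_def)
  then show ?thesis using that unfolding S_def L_def by blast
qed

lemma near_points_half:
  assumes "0 < r"
  obtains n where "pt (3 ^ n) / 2 \<le> measure lebesgue ({0..<pt (3 ^ n)} \<inter> {x. infdist x E_set < r})"
proof -
  obtain n where n: "measure lebesgue ({0..<pt (3 ^ n)} \<inter> {x. r \<le> infdist x E_set}) \<le> 1 / 2 * pt (3 ^ n)"
    using far_points_negligible[OF assms, of "1 / 2"] by auto
  have "{0..<pt (3 ^ n)} \<inter> {x. infdist x E_set < r}
      = {0..<pt (3 ^ n)} - ({0..<pt (3 ^ n)} \<inter> {x. r \<le> infdist x E_set})" by auto
  then have "measure lebesgue ({0..<pt (3 ^ n)} \<inter> {x. infdist x E_set < r})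
      = pt (3 ^ n) - measure lebesgue ({0..<pt (3 ^ n)} \<inter> {x. r \<le> infdist x E_set})"
    using measurable_measure_Diff[of "{0..<pt (3 ^ n)}" lebesgue
        "{0..<pt (3 ^ n)} \<inter> {x. r \<le> infdist x E_set}"] by simp
  then show ?thesis using n that[of n] by simp
qed

section \<open>Failure of the \<open>A\<^sub>1\<close> condition\<close>

lemma pt_1 [simp]: "pt (Suc 0) = 1" by (simp add: pt_def)

lemma pt_pow3_ge_1: "1 \<le> pt (3 ^ n)"
  using pt_le_iff[of 1 "3 ^ n"] by simp

lemma infdist_E_mid:
  assumes "x \<in> {1/4..3/4}"
  shows "1 / 4 \<le> infdist x E_set"
  using infdist_E_gap[of 0 x] assms by auto

lemma ess_inf_dist_weight_le:
  assumes "0 < \<alpha>" "{1/4..3/4} \<subseteq> Q"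
  shows "ess_inf_on Q (dist_weight E_set \<alpha>) \<le> ennreal (4 powr \<alpha>)"
  unfolding ess_inf_on_def
proof (rule Sup_least, clarify)
  fix c assume c: "AE x in lebesgue. x \<in> Q \<longrightarrow> c \<le> dist_weight E_set \<alpha> x"
  have "\<exists>x\<in>{1/4..3/4}. c \<le> dist_weight E_set \<alpha> x"
  proof (rule ccontr)
    assume "\<not> ?thesis"
    then have "AE x in lebesgue. x \<notin> {1/4..3/4::real}"
      using c assms(2) by (auto elim!: eventually_mono)
    then have "emeasure lebesgue {1/4..3/4::real} = 0"
      by (subst (asm) AE_iff_measurable[of "{1/4..3/4}"]) auto
    then show False by simp
  qed
  then obtain x where x: "x \<in> {1/4..3/4}" "c \<le> dist_weight E_set \<alpha> x" by blast
  have "infdist x E_set powr - \<alpha> \<le> (1 / 4) powr - \<alpha>"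
    using infdist_E_mid[OF x(1)] assms by (intro powr_mono2') auto
  also have "\<dots> = 4 powr \<alpha>" by (simp add: powr_divide powr_minus)
  finally show "c \<le> ennreal (4 powr \<alpha>)"
    using x infdist_E_mid[OF x(1)] by (auto simp: dist_weight_eq intro: order_trans ennreal_leI)
qed

text \<open>At least half of some interval \<open>[0, L)\<close> lies within \<open>r\<close> of \<open>E\<close>, so the average there is at least
  \<open>r\<^bsup>-\<alpha>\<^esup>/2\<close>. The gap \<open>(0, 1)\<close> keeps the essential infimum at most \<open>4\<^sup>\<alpha>\<close>, and \<open>r\<close> is
  arbitrary.\<close>

lemma dist_weight_not_in_A_1:
  assumes \<alpha>: "0 < \<alpha>"
  shows "dist_weight E_set \<alpha> \<notin> A_1"
proof
  assume "dist_weight E_set \<alpha> \<in> A_1"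
  then obtain C where C: "\<And>Q. is_cube Q \<Longrightarrow>
      average Q (dist_weight E_set \<alpha>) \<le> ennreal C * ess_inf_on Q (dist_weight E_set \<alpha>)"
    unfolding A_1_def by blast
  \<comment> \<open>Chosen so that an average of at least \<open>K / 2\<close> violates the \<open>A\<^sub>1\<close> bound with constant \<open>C\<close>.\<close>
  define K where "K = 2 * (\<bar>C\<bar> * 4 powr \<alpha>) + 1"
  have K: "0 < K" by (simp add: K_def add_nonneg_pos)
  define r where "r = K powr (- 1 / \<alpha>)"
  have r: "0 < r" "r powr - \<alpha> = K" using K \<alpha> by (auto simp: r_def powr_powr)
  obtain n where n: "pt (3 ^ n) / 2 \<le> measure lebesgue ({0..<pt (3 ^ n)} \<inter> {x. infdist x E_set < r})"
    using near_points_half[OF r(1)] by blast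
  define L where "L = pt (3 ^ n)"
  define Q S where "Q = {0..<L}" and "S = Q \<inter> {x. infdist x E_set < r}"
  have L: "1 \<le> L" using pt_pow3_ge_1 by (simp add: L_def)
  have "{x. infdist x E_set < r} \<in> sets borel" by measurable
  then have S: "S \<in> lmeasurable" unfolding S_def Q_def by (intro fmeasurable_Int_fmeasurable) auto
  have "ennreal K * ennreal (L / 2) \<le> ennreal K * emeasure lebesgue S"
    using n S by (intro mult_left_mono) (auto simp: S_def Q_def L_def emeasure_eq_measure2 intro!: ennreal_leI)
  also have "\<dots> = (\<integral>\<^sup>+x. ennreal K * indicator S x \<partial>lebesgue)"
    using S by (simp add: nn_integral_cmult_indicator)
  also have "\<dots> \<le> (\<integral>\<^sup>+x\<in>Q. dist_weight E_set \<alpha> x \<partial>lebesgue)"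
    using dist_weight_ge[OF \<alpha> r(1)] r(2)
    by (intro nn_integral_mono) (auto simp: indicator_def S_def)
  finally have "ennreal (K * (L / 2)) / ennreal L
      \<le> (\<integral>\<^sup>+x\<in>Q. dist_weight E_set \<alpha> x \<partial>lebesgue) / ennreal L"
    using K L by (intro divide_right_mono_ennreal) (simp only: ennreal_mult')
  then have "ennreal (K / 2) \<le> average Q (dist_weight E_set \<alpha>)"
    using K L by (simp add: divide_ennreal average_def Q_def)
  also have "\<dots> \<le> ennreal C * ess_inf_on Q (dist_weight E_set \<alpha>)"
    using L unfolding Q_def by (intro C is_cube_Ico) simp
  also have "\<dots> \<le> ennreal \<bar>C\<bar> * ennreal (4 powr \<alpha>)"
    using L by (intro mult_mono ess_inf_dist_weight_le \<alpha> ennreal_leI) (auto simp: Q_def)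
  also have "\<dots> = ennreal (\<bar>C\<bar> * 4 powr \<alpha>)" by (simp add: ennreal_mult')
  finally have "K / 2 \<le> \<bar>C\<bar> * 4 powr \<alpha>" by (subst (asm) ennreal_le_iff) auto
  then show False by (simp add: K_def)
qed

section \<open>Failure of weak porosity\<close>

lemma dyadicE:
  assumes "Q \<in> dyadic {a..<b}" "a < b"
  obtains u j where "Q = {u..<u + (b - a) / 2 ^ j}" "Q \<subseteq> {a..<b}"
proof -
  obtain a' b' j k where *: "a' < b'" "{a..<b} = {a'..<b'}" "k < 2 ^ j"
    "Q = {a' + real k * ((b' - a') / 2 ^ j) ..< a' + real (k + 1) * ((b' - a') / 2 ^ j)}"
    using assms(1) unfolding dyadic_def by blast
  have [simp]: "a' = a" "b' = b" using *(1,2) assms(2) by (auto simp: Ico_eq_Ico)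
  have "real (k + 1) * ((b - a) / 2 ^ j) \<le> 2 ^ j * ((b - a) / 2 ^ j)"
  proof (rule mult_right_mono)
    have "real (k + 1) \<le> real (2 ^ j)" using *(3) by (subst of_nat_le_iff) simp
    then show "real (k + 1) \<le> 2 ^ j" by simp
  qed (use assms(2) in simp)
  then have "a + real (k + 1) * ((b - a) / 2 ^ j) \<le> b" by simp
  moreover have "0 \<le> real k * ((b - a) / 2 ^ j)" using assms(2) by simp
  ultimately have "Q \<subseteq> {a..<b}" unfolding *(4) by auto
  moreover have "Q = {a + real k * ((b - a) / 2 ^ j)..<a + real k * ((b - a) / 2 ^ j) + (b - a) / 2 ^ j}"
    unfolding *(4) by (simp add: distrib_right add_divide_distrib add.commute add.left_commute)
  ultimately show ?thesis using that by blast
qed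

text \<open>The choice in \<^const>\<open>max_free\<close> is meaningful as soon as there is a free dyadic interval:
  the lengths that occur are \<open>(b - a)/2\<^sup>j\<close>, so the least \<open>j\<close> gives a largest one.\<close>

lemma max_free_ge:
  assumes ab: "a < b" and Q: "Q \<in> free_dyadic E {a..<b}"
  shows "measure lebesgue Q \<le> measure lebesgue (max_free E {a..<b})"
proof -
  let ?F = "free_dyadic E {a..<b}"
  define P where "P j \<longleftrightarrow> (\<exists>Q\<in>?F. measure lebesgue Q = (b - a) / 2 ^ j)" for j :: nat
  have size: "\<exists>j. measure lebesgue Q = (b - a) / 2 ^ j" if "Q \<in> ?F" for Q
  proof -
    have "Q \<in> dyadic {a..<b}" using that by (simp add: free_dyadic_def)
    then obtain u j where "Q = {u..<u + (b - a) / 2 ^ j}" using dyadicE ab by metis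
    then show ?thesis using ab by (intro exI[of _ j]) simp
  qed
  define j where "j = (LEAST j. P j)"
  have "\<exists>j. P j" using Q size[OF Q] unfolding P_def by blast
  then have "P j" unfolding j_def by (rule LeastI_ex)
  then obtain R where R: "R \<in> ?F" "measure lebesgue R = (b - a) / 2 ^ j"
    unfolding P_def by blast
  have "measure lebesgue Q' \<le> measure lebesgue R" if Q': "Q' \<in> ?F" for Q'
  proof -
    obtain i where i: "measure lebesgue Q' = (b - a) / 2 ^ i" using size[OF Q'] by blast
    then have "P i" unfolding P_def using Q' by blast
    then have "j \<le> i" unfolding j_def by (rule Least_le)
    then have "(2::real) ^ j \<le> 2 ^ i" by simp
    then show ?thesis unfolding i R(2) using ab by (intro divide_left_mono) auto
  qed
  then have "\<exists>R. R \<in> ?F \<and> (\<forall>Q'\<in>?F. measure lebesgue Q' \<le> measure lebesgue R)" using R by blast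
  from someI_ex[OF this] show ?thesis using Q unfolding max_free_def by blast
qed

text \<open>The second dyadic interval \<open>[s, 2s)\<close> of the first generation with \<open>s \<le> 1/2\<close> lies in the gap
  \<open>(0, 1)\<close>; the first one does not qualify, as it contains \<open>0\<close>.\<close>

lemma max_free_E_ge:
  assumes L: "1 \<le> L"
  shows "1 / 4 \<le> measure lebesgue (max_free E_set {0..<L})"
proof -
  define P where "P j \<longleftrightarrow> L / 2 ^ j \<le> 1 / 2" for j :: nat
  have ex: "\<exists>j. P j"
  proof -
    obtain j where "2 * L < 2 ^ j" using real_arch_pow[of 2 "2 * L"] by auto
    then have "P j" by (simp add: P_def field_simps)
    then show ?thesis ..
  qed
  define j where "j = (LEAST j. P j)"
  have j: "P j" unfolding j_def using ex by (rule LeastI_ex)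
  have "j \<noteq> 0" using j L by (cases j) (auto simp: P_def)
  then obtain i where i: "j = Suc i" using not0_implies_Suc by blast
  have "\<not> P i" using not_less_Least[of i P] i unfolding j_def by simp
  define s where "s = L / 2 ^ j"
  have s: "s \<le> 1 / 2" "1 / 4 \<le> s" "0 < s"
    using j \<open>\<not> P i\<close> L by (auto simp: P_def s_def i)
  have j1: "1 < (2::nat) ^ j" using \<open>j \<noteq> 0\<close> by (intro one_less_power) auto
  have "{s..<2 * s} \<in> dyadic {0..<L}"
    unfolding dyadic_def mem_Collect_eq
    by (rule exI[of _ 0], rule exI[of _ L], rule exI[of _ j], rule exI[of _ 1])
      (use L j1 in \<open>auto simp: s_def\<close>)
  moreover have "E_set \<inter> {s..<2 * s} = {}"
  proof -
    have "e \<le> 0 \<or> 1 \<le> e" if "e \<in> E_set" for e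
      using E_set_disjoint_gap[OF that, of 0] by simp
    then show ?thesis using s by fastforce
  qed
  ultimately have "{s..<2 * s} \<in> free_dyadic E_set {0..<L}" by (simp add: free_dyadic_def)
  then show ?thesis using max_free_ge[of 0 L] L s by fastforce
qed

text \<open>The middle half of a free interval keeps a quarter of its length away from \<open>E\<close>.\<close>

lemma free_interval_far_half:
  assumes free: "E_set \<inter> {u..<v} = {}" and r: "r \<le> (v - u) / 4" and uv: "u \<le> v"
  shows "(v - u) / 2 \<le> measure lebesgue ({u..<v} \<inter> {x. r \<le> infdist x E_set})"
proof -
  define h where "h = (v - u) / 4"
  have "r \<le> infdist x E_set" if x: "x \<in> {u + h..<v - h}" for x
  proof (rule infdist_E_ge)
    fix e assume "e \<in> E_set"
    then have "e < u \<or> v \<le> e" using free by (auto simp: disjoint_iff)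
    moreover have "r \<le> h" "u + h \<le> x" "x < v - h" using x r by (auto simp: h_def)
    ultimately show "r \<le> dist x e" unfolding dist_real_def by linarith
  qed
  then have "{u + h..<v - h} \<subseteq> {u..<v} \<inter> {x. r \<le> infdist x E_set}"
    using uv by (auto simp: h_def)
  then have "measure lebesgue {u + h..<v - h} \<le> measure lebesgue ({u..<v} \<inter> {x. r \<le> infdist x E_set})"
    by (intro measure_mono_fmeasurable fmeasurable_Int_fmeasurable) auto
  then show ?thesis using uv by (simp add: h_def field_simps)
qed

text \<open>The intervals supplied by weak porosity of \<open>[0, L)\<close> have length at least \<open>\<delta>/4\<close>, so at least half of
  each consists of points at distance at least \<open>\<delta>/16\<close> from \<open>E\<close>. Together these points would
  fill at least a fraction \<open>c/2\<close> of \<open>[0, L)\<close>, for every \<open>L \<ge> 1\<close>.\<close>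

lemma not_weakly_porous_E: "\<not> weakly_porous E_set"
proof
  assume "weakly_porous E_set"
  then obtain c \<delta> :: real where c: "0 < c" and \<delta>: "0 < \<delta>" and
    cover: "\<And>P. is_cube P \<Longrightarrow> \<exists>(N::nat) Q. 1 \<le> N \<and>
            (\<forall>k\<in>{1..N}. Q k \<in> free_dyadic E_set P \<and>
               measure lebesgue (Q k) \<ge> \<delta> * measure lebesgue (max_free E_set P)) \<and>
            disjoint_family_on Q {1..N} \<and>
            (\<Sum>k=1..N. measure lebesgue (Q k)) \<ge> c * measure lebesgue P"
    unfolding weakly_porous_def by metis
  define r where "r = \<delta> / 16"
  define F where "F = {x. r \<le> infdist x E_set}"
  have r: "0 < r" using \<delta> by (simp add: r_def)
  obtain n where n: "measure lebesgue ({0..<pt (3 ^ n)} \<inter> F) \<le> c / 4 * pt (3 ^ n)"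
    unfolding F_def using far_points_negligible[OF r, of "c / 4"] c by auto
  define L where "L = pt (3 ^ n)"
  have L: "1 \<le> L" using pt_pow3_ge_1 by (simp add: L_def)
  have "is_cube {0..<L}" using L by (intro is_cube_Ico) simp
  then obtain N Q where Q: "\<And>k. k \<in> {1..N} \<Longrightarrow> Q k \<in> free_dyadic E_set {0..<L}"
      "\<And>k. k \<in> {1..N} \<Longrightarrow> measure lebesgue (Q k) \<ge> \<delta> * measure lebesgue (max_free E_set {0..<L})"
    and disj: "disjoint_family_on Q {1..N::nat}"
    and sum: "(\<Sum>k=1..N. measure lebesgue (Q k)) \<ge> c * measure lebesgue {0..<L}"
    using cover by meson
  have Qk: "Q k \<subseteq> {0..<L} \<and> Q k \<in> lmeasurable
      \<and> measure lebesgue (Q k) / 2 \<le> measure lebesgue (Q k \<inter> F)" if k: "k \<in> {1..N}" for k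
  proof -
    obtain u j where u: "Q k = {u..<u + (L - 0) / 2 ^ j}" "Q k \<subseteq> {0..<L}"
      using dyadicE[of "Q k" 0 L] Q(1)[OF k] L by (auto simp: free_dyadic_def)
    define l where "l = L / 2 ^ j"
    have l: "Q k = {u..<u + l}" "0 < l" using u L by (auto simp: l_def)
    have "\<delta> * (1 / 4) \<le> \<delta> * measure lebesgue (max_free E_set {0..<L})"
      using max_free_E_ge[OF L] \<delta> by (intro mult_left_mono) auto
    also have "\<dots> \<le> l" using Q(2)[OF k] l by simp
    finally have "r \<le> (u + l - u) / 4" by (simp add: r_def)
    moreover have "E_set \<inter> {u..<u + l} = {}" using Q(1)[OF k] l by (auto simp: free_dyadic_def)
    ultimately show ?thesis
      using free_interval_far_half[of u "u + l" r] l u(2) by (simp add: F_def)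
  qed
  have "c * L / 2 \<le> (\<Sum>k=1..N. measure lebesgue (Q k)) / 2"
    using sum L by simp
  also have "\<dots> \<le> (\<Sum>k=1..N. measure lebesgue (Q k \<inter> F))"
    unfolding sum_divide_distrib using Qk by (intro sum_mono) auto
  also have "\<dots> = measure lebesgue (\<Union>k\<in>{1..N}. Q k \<inter> F)"
  proof (rule measure_finite_Union[symmetric])
    have *: "Q k \<inter> F \<in> lmeasurable" if "k \<in> {1..N}" for k
      using Qk[OF that] by (intro fmeasurable_Int_fmeasurable) (auto simp: F_def)
    show "(\<lambda>k. Q k \<inter> F) ` {1..N} \<subseteq> sets lebesgue" using * by (auto intro: fmeasurableD)
    show "emeasure lebesgue (Q k \<inter> F) \<noteq> \<infinity>" if "k \<in> {1..N}" for k
      using fmeasurableD2[OF *[OF that]] by simp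
    show "disjoint_family_on (\<lambda>k. Q k \<inter> F) {1..N}"
      using disj by (auto simp: disjoint_family_on_def)
  qed simp
  also have "\<dots> \<le> measure lebesgue ({0..<L} \<inter> F)"
  proof (rule measure_mono_fmeasurable)
    show "(\<Union>k\<in>{1..N}. Q k \<inter> F) \<in> sets lebesgue"
      using Qk by (intro sets.finite_UN sets.Int) (auto simp: F_def intro: fmeasurableD)
    show "{0..<L} \<inter> F \<in> lmeasurable"
      by (intro fmeasurable_Int_fmeasurable) (auto simp: F_def)
    show "(\<Union>k\<in>{1..N}. Q k \<inter> F) \<subseteq> {0..<L} \<inter> F" using Qk by blast
  qed
  also have "\<dots> \<le> c / 4 * L" using n by (simp add: L_def)
  finally show False using c L by simp
qed

section \<open>The Muckenhoupt exponent\<close>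

lemma hole_bounds:
  fixes x R :: real
  shows "\<And>t. 0 < t \<Longrightarrow> y \<in> ball x R \<Longrightarrow> ball y t \<subseteq> ball x R - E \<Longrightarrow> t \<le> hole E (ball x R)"
    and "0 < R \<Longrightarrow> hole E (ball x R) \<le> R"
proof -
  let ?T = "insert 0 {t. 0 < t \<and> (\<exists>y\<in>ball x R. ball y t \<subseteq> ball x R - E)}"
  have bnd: "t \<le> max 0 R" if t: "t \<in> ?T" for t
  proof (cases "t = 0")
    case False
    then obtain y where "ball y t \<subseteq> ball x R" "0 < t"
      using t False by blast
    then have "dist y x + t \<le> R" by (simp add: ball_subset_ball_iff)
    then show ?thesis using zero_le_dist[of y x] by linarith
  qed simp
  then have bdd: "bdd_above ?T" by (intro bdd_aboveI)
  show "t \<le> hole E (ball x R)" if "0 < t" "y \<in> ball x R" "ball y t \<subseteq> ball x R - E" for t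
    unfolding hole_def using that by (intro cSup_upper bdd) auto
  show "hole E (ball x R) \<le> R" if "0 < R"
    unfolding hole_def using bnd that by (intro cSup_least) (auto simp: max_def)
qed

lemma hole_E_pos:
  assumes "0 < R"
  shows "0 < hole E_set (ball x R)"
proof -
  have "\<not> ball x R \<subseteq> E_set"
    using uncountable_ball[OF assms] countable_E_set countable_subset by blast
  then obtain y where y: "y \<in> ball x R" "y \<notin> E_set" by blast
  define t where "t = min (infdist y E_set) (R - dist x y)"
  have t: "0 < t" using infdist_E_pos[OF y(2)] y(1) by (simp add: t_def)
  have "ball y t \<subseteq> ball x R - E_set"
  proof
    fix z assume z: "z \<in> ball y t"
    then have "z \<notin> E_set" using infdist_le[of z E_set y] by (auto simp: t_def)
    moreover have "dist x z \<le> dist x y + dist y z" by (rule dist_triangle)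
    ultimately show "z \<in> ball x R - E_set" using z by (simp add: t_def)
  qed
  from hole_bounds(1)[OF t y(1) this] show ?thesis using t by simp
qed

text \<open>In balls centred at \<open>0\<close> with radius \<open>L \<ge> 1\<close> the largest hole has radius at least \<open>1/2\<close>, while
  for a suitable \<open>L\<close> the \<open>r\<close>-neighbourhood fills at least a quarter of the ball. A positive exponent would
  force this fraction below \<open>C (2r)\<^sup>\<alpha>\<close>, which tends to \<open>0\<close> with \<open>r\<close>.\<close>

lemma Mu_E_exponent_nonpos:
  assumes adm: "\<And>x r R. x \<in> E_set \<Longrightarrow> 0 < r \<Longrightarrow> r < hole E_set (ball x R) \<Longrightarrow> hole E_set (ball x R) \<le> R \<Longrightarrow>
      measure lebesgue (nbhd E_set r \<inter> ball x R) / measure lebesgue (ball x R)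
        \<le> C * (hole E_set (ball x R) / r) powr - \<alpha>"
  shows "\<alpha> \<le> 0"
proof (rule ccontr)
  assume "\<not> \<alpha> \<le> 0"
  then have \<alpha>: "0 < \<alpha>" by simp
  have key: "1 / 4 \<le> \<bar>C\<bar> * (2 * r) powr \<alpha>" if r: "0 < r" "r < 1 / 2" for r
  proof -
    obtain n where n: "pt (3 ^ n) / 2 \<le> measure lebesgue ({0..<pt (3 ^ n)} \<inter> {x. infdist x E_set < r})"
      using near_points_half[OF r(1)] by blast
    define L where "L = pt (3 ^ n)"
    have L: "1 \<le> L" using pt_pow3_ge_1 by (simp add: L_def)
    let ?B = "ball (0::real) L"
    define h where "h = hole E_set ?B"
    have "e \<le> 0 \<or> 1 \<le> e" if "e \<in> E_set" for e
      using E_set_disjoint_gap[OF that, of 0] by simp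
    then have "ball (1 / 2) (1 / 2) \<subseteq> ?B - E_set"
      using L by (fastforce simp: ball_eq_greaterThanLessThan)
    then have h: "1 / 2 \<le> h" unfolding h_def using L
      by (intro hole_bounds(1)[where y = "1 / 2"]) (auto simp: dist_real_def)
    have hL: "h \<le> L" unfolding h_def using L by (intro hole_bounds(2)) auto
    have "{x. infdist x E_set < r} \<in> sets borel" by measurable
    then have nb: "nbhd E_set r \<in> sets lebesgue" by (simp add: nbhd_def)
    have ball: "?B = {- L<..<L}" by (simp add: ball_eq_greaterThanLessThan)
    have "L / 2 \<le> measure lebesgue ({0..<L} \<inter> {x. infdist x E_set < r})" using n by (simp add: L_def)
    also have "\<dots> \<le> measure lebesgue (nbhd E_set r \<inter> ?B)"
    proof (rule measure_mono_fmeasurable)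
      show "nbhd E_set r \<inter> ?B \<in> lmeasurable"
        using nb by (subst Int_commute, intro fmeasurable_Int_fmeasurable) auto
      show "{0..<L} \<inter> {x. infdist x E_set < r} \<in> sets lebesgue"
        using nb by (auto simp: nbhd_def)
    qed (use L in \<open>auto simp: nbhd_def ball\<close>)
    finally have "1 / 4 \<le> measure lebesgue (nbhd E_set r \<inter> ?B) / measure lebesgue ?B"
      using L unfolding ball by (simp add: field_simps)
    also have "\<dots> \<le> C * (h / r) powr - \<alpha>"
      unfolding h_def
    proof (rule adm)
      show "0 \<in> E_set" using rangeI[of pt 0] by (simp add: E_set_eq)
    qed (use r h hL in \<open>auto simp: h_def\<close>)
    also have "\<dots> \<le> \<bar>C\<bar> * (1 / (2 * r)) powr - \<alpha>"
      using r h \<alpha> by (intro mult_mono powr_mono2') (auto simp: field_simps)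
    also have "(1 / (2 * r)) powr - \<alpha> = (2 * r) powr \<alpha>"
      using r by (simp add: powr_divide powr_minus)
    finally show ?thesis .
  qed
  \<comment> \<open>With \<open>r = q / 2\<close> and \<open>q\<^sup>\<alpha> = 1 / K\<close> the bound becomes \<open>K \<le> 4 \<bar>C\<bar>\<close>;
    the summand 2 contradicts this and ensures \<open>r < 1/2\<close>.\<close>
  define K where "K = 4 * \<bar>C\<bar> + 2"
  have K: "1 < K" by (simp add: K_def)
  define q where "q = K powr (- 1 / \<alpha>)"
  have "q < K powr 0" unfolding q_def using K \<alpha> by (intro powr_less_mono) auto
  then have q: "0 < q" "q < 1" "q powr \<alpha> = 1 / K"
    using K \<alpha> by (simp_all add: q_def powr_powr)
  have "1 / 4 \<le> \<bar>C\<bar> * (1 / K)" using key[of "q / 2"] q by simp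
  then show False using K by (simp add: field_simps K_def)
qed

text \<open>The exponent \<open>0\<close> is always admissible, with constant \<open>1\<close>.\<close>

lemma Mu_E: "Mu E_set = 0"
proof -
  define A where "A = {\<alpha>. \<exists>C::real. \<forall>x\<in>E_set. \<forall>r R.
             0 < r \<and> r < hole E_set (ball x R) \<and> hole E_set (ball x R) \<le> R \<longrightarrow>
             measure lebesgue (nbhd E_set r \<inter> ball x R) / measure lebesgue (ball x R)
               \<le> C * (hole E_set (ball x R) / r) powr (- \<alpha>)}"
  have le: "\<alpha> \<le> 0" if "\<alpha> \<in> A" for \<alpha>
  proof -
    from that obtain C where "\<forall>x\<in>E_set. \<forall>r R.
        0 < r \<and> r < hole E_set (ball x R) \<and> hole E_set (ball x R) \<le> R \<longrightarrow>
        measure lebesgue (nbhd E_set r \<inter> ball x R) / measure lebesgue (ball x R)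
          \<le> C * (hole E_set (ball x R) / r) powr (- \<alpha>)"
      unfolding A_def by blast
    then show ?thesis by (intro Mu_E_exponent_nonpos[of C]) auto
  qed
  have mem: "0 \<in> A"
    unfolding A_def mem_Collect_eq
  proof (rule exI[of _ 1], intro ballI allI impI)
    fix x r R :: real
    assume r: "0 < r \<and> r < hole E_set (ball x R) \<and> hole E_set (ball x R) \<le> R"
    have "{x. infdist x E_set < r} \<in> sets borel" by measurable
    then have "nbhd E_set r \<inter> ball x R \<in> sets lebesgue" by (simp add: nbhd_def)
    then have "measure lebesgue (nbhd E_set r \<inter> ball x R) \<le> measure lebesgue (ball x R)"
      by (intro measure_mono_fmeasurable) auto
    then show "measure lebesgue (nbhd E_set r \<inter> ball x R) / measure lebesgue (ball x R)
      \<le> 1 * (hole E_set (ball x R) / r) powr - 0"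
      using r by (simp add: divide_le_eq_1)
  qed
  have "Sup (ereal ` A) = 0"
  proof (rule antisym)
    show "Sup (ereal ` A) \<le> 0" using le by (intro Sup_least) auto
    show "0 \<le> Sup (ereal ` A)" unfolding zero_ereal_def using mem by (intro Sup_upper) auto
  qed
  moreover have "\<forall>x\<in>E_set. \<forall>R>0. hole E_set (ball x R) > 0" using hole_E_pos by blast
  ultimately show ?thesis unfolding Mu_def A_def by simp
qed

theorem theorem8p1:
  shows "(\<forall>\<alpha> p. 0 < \<alpha> \<and> \<alpha> < 1 \<and> 1 < p \<longrightarrow> dist_weight E_set \<alpha> \<in> A_p p - A_1)
    \<and> \<not> weakly_porous E_set
    \<and> Mu E_set = 0"
  using dist_weight_in_A_p dist_weight_not_in_A_1 not_weakly_porous_E Mu_E by blast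

end
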